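(* Let $n>2$ and consider on $SO(n)$ the dynamics $$\tfrac{d}{dt}Q = 2Q\,\mathrm{skew}(Q^T M_{12}),\qquad M_{12}=y_{12}y_{12}^T,\quad y_{12}\in S^{n-1}.$$ (a) Let $Z_y=\{Q\in SO(n): Qy_{12}=-y_{12}\}$, the set of maxima of $\hat f_o$. If $y_{12}$ is constant, then all trajectories with initial condition $Q(0)\in SO(n)\setminus Z_y$ asymptotically converge to $\hat C_o$; convergence is locally exponential. Moreover, initial points in $$S_0=\{I_n+(\cos\theta-1)(y_{12}y_{12}^T+zz^T)+\sin\theta\,(y_{12}z^T-zy_{12}^T) : z\in S^{n-1},\ z^Ty_{12}=0,\ \theta\in(-\pi,\pi)\}$$ converge to $\hat C_s$, and only initial points in $S_0$ do so. (b) If $y_{12}(t)$ is a time-varying smooth function, $\tfrac{d}{dt}y_{12}$ is uniformly bounded, and there exist $T,\alpha>0$ such that $\tfrac1T\int_t^{t+T}M_{12}(\tau)\,d\tau-\alpha I_n$ is positive definite for all $t>0$, then $\hat C_s$ is the only asymptotically stable limit set and it attracts (at least) all solutions starting in $SO(n)\setminus S_1$, where $S_1=\{Q\in SO(n):\hat f_s(Q)\ge 2\}$.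
   Context: $S^{n-1}$ is the unit sphere of $\mathbb{R}^n$; $\mathrm{skew}(X)=\tfrac12(X-X^T)$; $\|M\|_F=\sqrt{\mathrm{tr}(M^TM)}$; $\|\cdot\|_2$ is the Euclidean norm. The cost functions are $\hat f_s(Q)=\|Q^T-I_n\|_F^2$ and $\hat f_o(Q)=\|Q^Ty_{12}-y_{12}\|_2^2$. The sets are $\hat C_s=\{I_n\}$ and $\hat C_o=\{Q\in SO(n):\hat f_o(Q)=0\}=\{Q\in SO(n): Qy_{12}=y_{12}\}$. (Here $Q=Q_1Q_2^T$ is the relative state of two agents.) *)

theory Defs
  imports "HOL-Analysis.Analysis"
begin

subsection \<open>Matrices and cost functions\<close>

definition SO :: "(real^'n^'n) set" where
  "SO = {Q. rotation_matrix Q}"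

definition skew :: "real^'n^'n \<Rightarrow> real^'n^'n" where
  "skew X = (1/2) *\<^sub>R (X - transpose X)"

definition frob_norm :: "real^'n^'n \<Rightarrow> real" where
  "frob_norm M = sqrt (trace (transpose M ** M))"

(* Hence norm, dist and infdist on matrices below are all Frobenius. *)
lemma frob_norm_eq_norm: "frob_norm M = norm M"
proof -
  have "trace (transpose M ** M) = (\<Sum>i\<in>UNIV. \<Sum>j\<in>UNIV. (M$j$i)\<^sup>2)"
    by (simp add: trace_def transpose_def matrix_matrix_mult_def power2_eq_square)
  also have "\<dots> = (\<Sum>j\<in>UNIV. \<Sum>i\<in>UNIV. (M$j$i)\<^sup>2)"
    by (rule sum.swap)
  also have "\<dots> = (\<Sum>j\<in>UNIV. (norm (M$j))\<^sup>2)"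
    by (simp add: norm_vec_def L2_set_def sum_nonneg)
  finally show ?thesis
    by (simp add: frob_norm_def norm_vec_def[of M] L2_set_def)
qed

definition outer :: "real^'n \<Rightarrow> real^'n \<Rightarrow> real^'n^'n" where
  "outer v w = (\<chi> i j. v$i * w$j)"

definition M12 :: "real^'n \<Rightarrow> real^'n^'n" where
  "M12 y = outer y y"

definition positive_definite :: "real^'n^'n \<Rightarrow> bool" where
  "positive_definite A \<longleftrightarrow> transpose A = A \<and> (\<forall>x. x \<noteq> 0 \<longrightarrow> x \<bullet> (A *v x) > 0)"

definition f_s :: "real^'n^'n \<Rightarrow> real" where
  "f_s Q = (frob_norm (transpose Q - mat 1))\<^sup>2"

definition f_o :: "real^'n \<Rightarrow> real^'n^'n \<Rightarrow> real" where
  "f_o y Q = (norm (transpose Q *v y - y))\<^sup>2"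

definition C_s :: "(real^'n^'n) set" where
  "C_s = {mat 1}"

definition C_o :: "real^'n \<Rightarrow> (real^'n^'n) set" where
  "C_o y = {Q \<in> SO. f_o y Q = 0}"

lemma C_o_alt:
  fixes y :: "real^'n"
  shows "C_o y = {Q \<in> SO. Q *v y = y}"
proof -
  have "transpose Q *v y = y \<longleftrightarrow> Q *v y = y" if "Q \<in> SO" for Q :: "real^'n^'n"
  proof -
    have Q: "transpose Q ** Q = mat 1" "Q ** transpose Q = mat 1"
      using that by (auto simp: SO_def rotation_matrix_def orthogonal_matrix_def)
    show ?thesis
      by (metis Q matrix_vector_mul_assoc matrix_vector_mul_lid)
  qed
  then show ?thesis by (auto simp: C_o_def f_o_def)
qed

definition Z_y :: "real^'n \<Rightarrow> (real^'n^'n) set" where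
  "Z_y y = {Q \<in> SO. Q *v y = - y}"

definition S_0 :: "real^'n \<Rightarrow> (real^'n^'n) set" where
  "S_0 y = {mat 1 + (cos \<theta> - 1) *\<^sub>R (outer y y + outer z z)
                  + sin \<theta> *\<^sub>R (outer y z - outer z y) | z \<theta>.
            z \<in> sphere 0 1 \<and> z \<bullet> y = 0 \<and> \<theta> \<in> {-pi<..<pi}}"

definition S_1 :: "(real^'n^'n) set" where
  "S_1 = {Q \<in> SO. f_s Q \<ge> 2}"

subsection \<open>Trajectories and asymptotic behaviour\<close>

(* The equation is non-autonomous when y varies, hence the initial time t0. *)
definition trajectory ::
  "(real \<Rightarrow> real^'n) \<Rightarrow> real \<Rightarrow> (real \<Rightarrow> real^'n^'n) \<Rightarrow> bool" where
  "trajectory y t0 Q \<longleftrightarrow>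
     (\<forall>t\<ge>t0. Q t \<in> SO \<and>
        (Q has_vector_derivative 2 *\<^sub>R (Q t ** skew (transpose (Q t) ** M12 (y t))))
          (at t within {t0..}))"

definition converges_to :: "(real \<Rightarrow> real^'n^'n) \<Rightarrow> (real^'n^'n) set \<Rightarrow> bool" where
  "converges_to Q C \<longleftrightarrow> ((\<lambda>t. infdist (Q t) C) \<longlongrightarrow> 0) at_top"

(* Stated for initial time 0 only, since it is used for constant y. *)
definition locally_exponentially_convergent ::
  "(real \<Rightarrow> real^'n) \<Rightarrow> (real^'n^'n) set \<Rightarrow> bool" where
  "locally_exponentially_convergent y C \<longleftrightarrow>
     (\<exists>r>0. \<exists>K>0. \<exists>\<mu>>0. \<forall>Q. trajectory y 0 Q \<and> infdist (Q 0) C < r \<longrightarrow>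
        (\<forall>t\<ge>0. infdist (Q t) C \<le> K * exp (- \<mu> * t) * infdist (Q 0) C))"

definition omega_limit :: "(real \<Rightarrow> real^'n^'n) \<Rightarrow> (real^'n^'n) set" where
  "omega_limit Q =
     {P. \<exists>s :: nat \<Rightarrow> real. filterlim s at_top sequentially \<and> (\<lambda>k. Q (s k)) \<longlonglongrightarrow> P}"

definition limit_set :: "(real \<Rightarrow> real^'n) \<Rightarrow> (real^'n^'n) set \<Rightarrow> bool" where
  "limit_set y L \<longleftrightarrow> (\<exists>t0\<ge>0. \<exists>Q. trajectory y t0 Q \<and> L = omega_limit Q)"

(* Lyapunov stability plus local attractivity for a non-autonomous system: as usual, the
   radii may depend on the initial time. *)
definition stable :: "(real \<Rightarrow> real^'n) \<Rightarrow> (real^'n^'n) set \<Rightarrow> bool" where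
  "stable y L \<longleftrightarrow>
     (\<forall>t0\<ge>0. \<forall>\<epsilon>>0. \<exists>\<delta>>0. \<forall>Q. trajectory y t0 Q \<and> infdist (Q t0) L < \<delta> \<longrightarrow>
        (\<forall>t\<ge>t0. infdist (Q t) L < \<epsilon>))"

definition locally_attractive :: "(real \<Rightarrow> real^'n) \<Rightarrow> (real^'n^'n) set \<Rightarrow> bool" where
  "locally_attractive y L \<longleftrightarrow>
     (\<forall>t0\<ge>0. \<exists>\<eta>>0. \<forall>Q. trajectory y t0 Q \<and> infdist (Q t0) L < \<eta> \<longrightarrow> converges_to Q L)"

definition asymptotically_stable :: "(real \<Rightarrow> real^'n) \<Rightarrow> (real^'n^'n) set \<Rightarrow> bool" where
  "asymptotically_stable y L \<longleftrightarrow> stable y L \<and> locally_attractive y L"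

(* C-infinity on S: D k is the k-th derivative, one-sided at end points of an interval S. *)
definition smooth_within :: "(real \<Rightarrow> 'a::real_normed_vector) \<Rightarrow> real set \<Rightarrow> bool" where
  "smooth_within f S \<longleftrightarrow>
     (\<exists>D :: nat \<Rightarrow> real \<Rightarrow> 'a. (\<forall>t\<in>S. D 0 t = f t) \<and>
        (\<forall>k. \<forall>t\<in>S. (D k has_vector_derivative D (Suc k) t) (at t within S)))"

end

theory Submission
  imports Defs
begin

text \<open>
  On \<open>SO\<close> the equation reads \<open>Q' = y y\<^sup>T - (Q y) (Q\<^sup>T y)\<^sup>T\<close>.

  For constant \<open>y\<close> it is solved explicitly. The cosine \<open>c = y \<bullet> Q y\<close> satisfies \<open>c' = 1 - c\<^sup>2\<close>,
  hence \<open>c = D' / D\<close> with \<open>D = cosh t + c(0) sinh t\<close>, and the components of \<open>Q y\<close> and \<open>Q\<^sup>T y\<close>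
  orthogonal to \<open>y\<close> are their initial values divided by \<open>D\<close>. The limit of \<open>Q\<close> is then a closed
  expression in \<open>Q(0)\<close>, and \<open>S_0\<close> consists of the initial points for which it is the identity.

  For time-varying \<open>y\<close> let \<open>W = Q - Q\<^sup>T\<close>. Then \<open>(tr Q)' = |W y|\<^sup>2 / 2\<close> and \<open>|W'| \<le> 2 |W y|\<close>. The trace
  is bounded, so over a window of length \<open>T\<close> the quantity \<open>\<integral> |W y|\<^sup>2\<close> tends to zero and \<open>W\<close> becomes almost
  constant; persistent excitation then forces \<open>W \<rightarrow> 0\<close> along every trajectory. Limit points are thus
  symmetric rotations with a common trace. Near the identity this leaves only the identity; any other
  symmetric rotation has a \<open>-1\<close> eigenspace of dimension at least two, and rotating in it increases the
  trace, so that nearby trajectories cannot return.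
\<close>

text \<open>Transposes acting on column vectors are the working form; this simp rule would turn them
  into row-vector products \<open>x v* A\<close>.\<close>

declare transpose_matrix_vector [simp del]

section \<open>Frobenius inner product and norm of matrices\<close>

lemma inner_transpose_mult:
  fixes A :: "real^'n^'m"
  shows "(transpose A *v x) \<bullet> y = x \<bullet> (A *v y)"
  by (simp add: dot_lmul_matrix transpose_matrix_vector)

lemma inner_matrix_eq_sum:
  fixes A B :: "real^'n^'m"
  shows "A \<bullet> B = (\<Sum>i\<in>UNIV. \<Sum>j\<in>UNIV. A$i$j * B$i$j)"
  by (simp add: inner_vec_def)

lemma inner_matrix_eq_trace:
  fixes A B :: "real^'n^'m"
  shows "A \<bullet> B = trace (transpose A ** B)"
proof -
  have "trace (transpose A ** B) = (\<Sum>i\<in>UNIV. \<Sum>j\<in>UNIV. A$j$i * B$j$i)"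
    by (simp add: trace_def transpose_def matrix_matrix_mult_def)
  also have "\<dots> = (\<Sum>j\<in>UNIV. \<Sum>i\<in>UNIV. A$j$i * B$j$i)"
    by (rule sum.swap)
  finally show ?thesis by (simp add: inner_matrix_eq_sum)
qed

lemma trace_eq_inner_mat_1: "trace (A :: real^'n^'n) = A \<bullet> mat 1"
  by (subst inner_commute) (simp add: inner_matrix_eq_trace)

lemma transpose_diff: "transpose (A - B) = transpose A - transpose (B :: real^'n^'m)"
  by (simp add: transpose_def vec_eq_iff)

lemma transpose_add: "transpose (A + B) = transpose A + transpose (B :: real^'n^'m)"
  by (simp add: transpose_def vec_eq_iff)

lemma transpose_scaleR: "transpose (c *\<^sub>R A) = c *\<^sub>R transpose (A :: real^'n^'m)"
  by (simp add: transpose_def vec_eq_iff)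

lemma inner_transpose_transpose:
  fixes A B :: "real^'n^'m"
  shows "transpose A \<bullet> transpose B = A \<bullet> B"
  by (simp add: inner_matrix_eq_sum transpose_def) (rule sum.swap)

lemma norm_transpose:
  fixes A :: "real^'n^'m"
  shows "norm (transpose A) = norm A"
  by (simp add: norm_eq_sqrt_inner inner_transpose_transpose)

text \<open>Cauchy-Schwarz in each row: the Frobenius norm dominates the operator norm.\<close>

lemma norm_matrix_vector_mult_le:
  fixes A :: "real^'n^'m"
  shows "norm (A *v x) \<le> norm A * norm x"
proof -
  have "norm (A *v x) \<le> L2_set (\<lambda>i. norm (A$i) * norm x) UNIV"
    unfolding norm_vec_def[of "A *v x"]
    by (rule L2_set_mono)
      (auto simp: matrix_mult_dot Cauchy_Schwarz_ineq2)
  also have "\<dots> = norm A * norm x"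
    by (simp add: norm_vec_def[of A] L2_set_left_distrib)
  finally show ?thesis .
qed

text \<open>Row i of \<open>A ** B\<close> is \<open>transpose B\<close> applied to row i of
  \<open>A\<close>, so the vector bound applies row by row.\<close>

lemma norm_matrix_mult_le:
  fixes A :: "real^'n^'m" and B :: "real^'k^'n"
  shows "norm (A ** B) \<le> norm A * norm B"
proof -
  have row: "(A ** B)$i = transpose B *v (A$i)" for i
    by (simp add: vec_eq_iff matrix_matrix_mult_def matrix_vector_mult_def transpose_def mult.commute)
  have "norm (A ** B) \<le> L2_set (\<lambda>i. norm (A$i) * norm B) UNIV"
    unfolding norm_vec_def[of "A ** B"]
  proof (rule L2_set_mono)
    fix i
    show "norm ((A ** B)$i) \<le> norm (A$i) * norm B"
      using norm_matrix_vector_mult_le[of "transpose B" "A$i"]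
      by (simp add: row norm_transpose mult.commute)
  qed auto
  also have "\<dots> = norm A * norm B"
    by (simp add: norm_vec_def[of A] L2_set_left_distrib)
  finally show ?thesis .
qed

lemma matrix_mult_scaleR:
  fixes A :: "real^'n^'m" and B :: "real^'k^'n"
  shows "(c *\<^sub>R A) ** B = c *\<^sub>R (A ** B)" "A ** (c *\<^sub>R B) = c *\<^sub>R (A ** B)"
  by (simp_all add: scalar_matrix_assoc matrix_scalar_ac flip: scalar_mult_eq_scaleR)

lemma matrix_add_rdistrib: "(A + B) ** C = A ** C + B ** (C :: real^'k^'n)" for A B :: "real^'n^'m"
  by (simp add: matrix_matrix_mult_def vec_eq_iff sum.distrib algebra_simps)

text \<open>Supplies the product rule and continuity for matrix products.\<close>

lemma bounded_bilinear_matrix_mult: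
  "bounded_bilinear ((**) :: real^'n^'m \<Rightarrow> real^'k^'n \<Rightarrow> real^'k^'m)"
  by (rule bounded_bilinear.intro)
    (auto simp: matrix_add_ldistrib matrix_add_rdistrib matrix_mult_scaleR
      intro!: exI[of _ 1] norm_matrix_mult_le)

lemma bounded_linear_transpose:
  "bounded_linear (transpose :: real^'n^'m \<Rightarrow> real^'m^'n)"
  by (rule bounded_linear_intro[where K = 1]) (auto simp: transpose_add transpose_scaleR norm_transpose)

lemma bounded_linear_matrix_vector_mult_left:
  "bounded_linear (\<lambda>A :: real^'n^'m. A *v x)"
  by (rule bounded_linear_intro[where K = "norm x"])
    (auto simp: matrix_vector_mult_add_rdistrib scaleR_matrix_vector_assoc norm_matrix_vector_mult_le)

section \<open>Rank-one matrices\<close>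

lemma outer_vec: "outer v w *v x = (w \<bullet> x) *\<^sub>R v"
  by (simp add: outer_def vec_eq_iff matrix_vector_mult_def inner_vec_def sum_distrib_left mult_ac)

lemma transpose_outer: "transpose (outer v w) = outer w v"
  by (simp add: outer_def transpose_def vec_eq_iff mult.commute)

lemma matrix_mult_outer: "A ** outer v w = outer (A *v v) w"
  by (simp add: outer_def vec_eq_iff matrix_matrix_mult_def matrix_vector_mult_def
      sum_distrib_right mult.assoc)

lemma outer_matrix_mult: "outer v w ** A = outer v (transpose A *v w)"
  by (simp add: outer_def vec_eq_iff matrix_matrix_mult_def matrix_vector_mult_def transpose_def
      sum_distrib_left mult_ac)

lemma trace_outer: "trace (outer v w) = v \<bullet> w"
  by (simp add: outer_def trace_def inner_vec_def)

lemma norm_outer: "norm (outer v w) = norm v * norm w"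
proof -
  have row: "(outer v w)$i = v$i *\<^sub>R w" for i
    by (simp add: outer_def vec_eq_iff)
  show ?thesis
    by (simp add: norm_vec_def[of "outer v w"] norm_vec_def[of v] row L2_set_left_distrib)
qed

lemma bounded_bilinear_outer: "bounded_bilinear outer"
  by (rule bounded_bilinear.intro)
    (auto simp: outer_def vec_eq_iff algebra_simps norm_outer[unfolded outer_def] intro!: exI[of _ 1])

lemmas outer_linear =
  bounded_bilinear.add_left[OF bounded_bilinear_outer]
  bounded_bilinear.add_right[OF bounded_bilinear_outer]
  bounded_bilinear.diff_left[OF bounded_bilinear_outer]
  bounded_bilinear.diff_right[OF bounded_bilinear_outer]
  bounded_bilinear.scaleR_left[OF bounded_bilinear_outer]
  bounded_bilinear.scaleR_right[OF bounded_bilinear_outer]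
  bounded_bilinear.minus_left[OF bounded_bilinear_outer]
  bounded_bilinear.minus_right[OF bounded_bilinear_outer]
  bounded_bilinear.zero_left[OF bounded_bilinear_outer]
  bounded_bilinear.zero_right[OF bounded_bilinear_outer]

subsection \<open>Rotations\<close>

lemma SO_iff: "Q \<in> SO \<longleftrightarrow> transpose Q ** Q = mat 1 \<and> det Q = 1" for Q :: "real^'n^'n"
  by (simp add: SO_def rotation_matrix_def orthogonal_matrix)

lemma SO_inverse:
  assumes "Q \<in> SO"
  shows "transpose Q ** Q = mat 1" "Q ** transpose Q = mat 1"
  using assms by (auto simp: SO_def rotation_matrix_def orthogonal_matrix_def)

lemma mat_1_in_SO: "mat 1 \<in> SO"
  by (simp add: SO_iff transpose_mat)

lemmas matrix_diff_distrib =
  bounded_bilinear.diff_left[OF bounded_bilinear_matrix_mult]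
  bounded_bilinear.diff_right[OF bounded_bilinear_matrix_mult]

lemma SO_matrix_mult:
  assumes "P \<in> SO" "Q \<in> SO"
  shows "P ** Q \<in> SO"
  using assms by (auto simp: SO_def rotation_matrix_def orthogonal_matrix_mul det_mul)

lemma transpose_in_SO: "Q \<in> SO \<Longrightarrow> transpose Q \<in> SO"
  by (auto simp: SO_def rotation_matrix_def orthogonal_matrix_transpose det_transpose)

lemma inner_SO:
  assumes "Q \<in> SO"
  shows "(Q *v x) \<bullet> (Q *v y) = x \<bullet> y"
  by (metis SO_inverse(1)[OF assms] inner_commute inner_transpose_mult
      matrix_vector_mul_assoc matrix_vector_mul_lid)

lemma norm_SO: "Q \<in> SO \<Longrightarrow> norm (Q *v x) = norm x"
  by (simp add: norm_eq_sqrt_inner inner_SO)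

lemma norm_transpose_SO: "Q \<in> SO \<Longrightarrow> norm (transpose Q *v x) = norm x"
  by (simp add: norm_SO transpose_in_SO)

lemma trace_mat_1: "trace (mat 1 :: real^'n^'n) = CARD('n)"
  by (simp add: trace_def mat_def)

lemma norm_matrix_power2: "(norm (A :: real^'n^'m))\<^sup>2 = A \<bullet> A"
  by (simp add: power2_norm_eq_inner)

lemma norm_power2_SO: "Q \<in> SO \<Longrightarrow> (norm (Q :: real^'n^'n))\<^sup>2 = CARD('n)"
  by (simp add: norm_matrix_power2 inner_matrix_eq_trace SO_inverse trace_mat_1)

lemma norm_diff_mat_1_SO:
  assumes "Q \<in> SO"
  shows "(norm (Q - mat 1))\<^sup>2 = 2 * (CARD('n) - trace (Q :: real^'n^'n))"
  using norm_power2_SO[OF assms] norm_power2_SO[OF mat_1_in_SO, where 'n = 'n]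
  by (simp add: power2_norm_eq_inner trace_eq_inner_mat_1 inner_diff inner_commute algebra_simps)

lemma f_s_eq: "f_s Q = (norm (Q - mat 1))\<^sup>2"
  using norm_transpose[of "Q - mat 1"] by (simp add: f_s_def frob_norm_eq_norm transpose_diff transpose_mat)

lemma closed_SO: "closed (SO :: (real^'n^'n) set)"
proof -
  have "SO = {Q :: real^'n^'n. transpose Q ** Q = mat 1 \<and> det Q = 1}"
    by (auto simp: SO_iff)
  moreover have "closed {Q :: real^'n^'n. transpose Q ** Q = mat 1 \<and> det Q = 1}"
    unfolding det_def
    by (intro closed_Collect_conj closed_Collect_eq continuous_intros
        bounded_bilinear.continuous_on[OF bounded_bilinear_matrix_mult]
        bounded_linear.continuous_on[OF bounded_linear_transpose])
  ultimately show ?thesis by simp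
qed

lemma compact_SO: "compact (SO :: (real^'n^'n) set)"
proof -
  have "norm Q \<le> sqrt CARD('n)" if "Q \<in> SO" for Q :: "real^'n^'n"
    by (metis norm_power2_SO[OF that] norm_ge_zero order_refl real_sqrt_unique)
  then show ?thesis
    by (auto simp: compact_eq_bounded_closed closed_SO bounded_iff)
qed

text \<open>The determinant is continuous with values in \<open>{-1, 1}\<close>, so it cannot jump along a path.\<close>
lemma orthogonal_path_in_SO:
  fixes Q :: "real \<Rightarrow> real^'n^'n"
  assumes cont: "continuous_on {a..b} Q" and orth: "\<And>t. t \<in> {a..b} \<Longrightarrow> transpose (Q t) ** Q t = mat 1"
    and "det (Q a) = 1" "a \<le> b"
  shows "Q b \<in> SO"
proof -
  have det: "det (Q t) = 1 \<or> det (Q t) = -1" if "t \<in> {a..b}" for t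
    using orth[OF that] by (simp add: det_orthogonal_matrix orthogonal_matrix)
  have "continuous_on {a..b} (\<lambda>t. det (Q t))"
    unfolding det_def by (intro continuous_intros cont)
  then have "connected ((\<lambda>t. det (Q t)) ` {a..b})"
    by (intro connected_continuous_image) auto
  then have "is_interval ((\<lambda>t. det (Q t)) ` {a..b})"
    by (simp add: is_interval_connected_1)
  then have "det (Q b) \<noteq> -1"
    using mem_is_interval_1_I[of "(\<lambda>t. det (Q t)) ` {a..b}" "-1" 1 0] det
      \<open>det (Q a) = 1\<close> \<open>a \<le> b\<close> by (force simp: image_iff)
  then show ?thesis
    using det[of b] orth[of b] \<open>a \<le> b\<close> by (auto simp: SO_iff)
qed

subsection \<open>Functions with a one-sided derivative on a half-line\<close>

lemma has_integral_of_derivative_on_halfline: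
  fixes f :: "real \<Rightarrow> 'a::banach"
  assumes "\<And>t. t \<ge> t0 \<Longrightarrow> (f has_vector_derivative f' t) (at t within {t0..})" "t0 \<le> s" "s \<le> t"
  shows "(f' has_integral (f t - f s)) {s..t}"
  using assms(2,3)
  by (intro fundamental_theorem_of_calculus)
    (auto intro!: has_vector_derivative_within_subset[OF assms(1)])

lemma mono_of_derivative_on_halfline:
  fixes f :: "real \<Rightarrow> real"
  assumes "\<And>t. t \<ge> t0 \<Longrightarrow> (f has_vector_derivative f' t) (at t within {t0..})"
    and "\<And>t. t \<ge> t0 \<Longrightarrow> f' t \<ge> 0" "t0 \<le> s" "s \<le> t"
  shows "f s \<le> f t"
  using has_integral_nonneg[OF has_integral_of_derivative_on_halfline[OF assms(1,3,4)]] assms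
  by simp

text \<open>Mean value inequality, by integrating both derivatives. It serves the estimates for the
  Picard operator and the bound on the speed of \<open>W\<close>.\<close>

lemma norm_diff_le_of_derivative_on_halfline:
  fixes f :: "real \<Rightarrow> 'a::banach" and g :: "real \<Rightarrow> real"
  assumes "\<And>t. t \<ge> t0 \<Longrightarrow> (f has_vector_derivative f' t) (at t within {t0..})"
    and "\<And>t. t \<ge> t0 \<Longrightarrow> (g has_vector_derivative g' t) (at t within {t0..})"
    and "\<And>t. t \<ge> t0 \<Longrightarrow> norm (f' t) \<le> g' t" "t0 \<le> s" "s \<le> t"
  shows "norm (f t - f s) \<le> g t - g s"
proof -
  note I = has_integral_of_derivative_on_halfline[OF assms(1,4,5)]
    has_integral_of_derivative_on_halfline[OF assms(2,4,5)]
  have "norm (integral {s..t} f') \<le> integral {s..t} g'"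
    using I assms(3,4) by (intro integral_norm_bound_integral) (auto simp: integrable_on_def)
  then show ?thesis
    using I by (simp add: integral_unique)
qed

lemma constant_of_derivative_on_halfline:
  fixes f :: "real \<Rightarrow> 'a::banach"
  assumes "\<And>t. t \<ge> t0 \<Longrightarrow> (f has_vector_derivative 0) (at t within {t0..})" "t0 \<le> t"
  shows "f t = f t0"
  using has_integral_of_derivative_on_halfline[OF assms(1), of t0 t] assms(2)
  by (auto dest: has_integral_unique[OF has_integral_0])

subsection \<open>The vector field\<close>

text \<open>Orthogonality is not assumed: existence of trajectories is proved from this form,
  \<open>Q\<close> times a skew matrix, before the solution is known to stay in
  \<open>SO\<close>.\<close>

lemma field_eq:
  "2 *\<^sub>R (Q ** skew (transpose Q ** M12 y))
     = Q ** (outer (transpose Q *v y) y - outer y (transpose Q *v y))"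
  by (simp add: skew_def M12_def matrix_mult_outer outer_matrix_mult matrix_transpose_mul
      transpose_outer matrix_mult_scaleR transpose_transpose)

lemma field_eq_SO:
  assumes "Q \<in> SO"
  shows "2 *\<^sub>R (Q ** skew (transpose Q ** M12 y))
     = outer y y - outer (Q *v y) (transpose Q *v y)"
  by (simp add: field_eq matrix_diff_distrib matrix_mult_outer matrix_vector_mul_assoc SO_inverse[OF assms])

lemma trajectory_in_SO: "trajectory y t0 Q \<Longrightarrow> t \<ge> t0 \<Longrightarrow> Q t \<in> SO"
  by (simp add: trajectory_def)

lemma trajectory_derivative:
  assumes "trajectory y t0 Q" "t \<ge> t0"
  shows "(Q has_vector_derivative outer (y t) (y t) - outer (Q t *v y t) (transpose (Q t) *v y t))
    (at t within {t0..})"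
  using assms unfolding trajectory_def by (metis field_eq_SO)

lemma trajectoryI:
  assumes "\<And>t. t \<ge> t0 \<Longrightarrow> Q t \<in> SO"
    and "\<And>t. t \<ge> t0 \<Longrightarrow>
      (Q has_vector_derivative outer (y t) (y t) - outer (Q t *v y t) (transpose (Q t) *v y t))
      (at t within {t0..})"
  shows "trajectory y t0 Q"
  using assms by (simp add: trajectory_def field_eq_SO)

lemma infdist_C_s: "infdist Q C_s = norm (Q - mat 1)"
  by (simp add: C_s_def dist_norm)

lemma converges_to_C_s_iff: "converges_to Q C_s \<longleftrightarrow> (Q \<longlongrightarrow> mat 1) at_top"
  by (simp add: converges_to_def infdist_C_s tendsto_norm_zero_iff LIM_zero_iff)

subsection \<open>The maxima of the cost\<close>

lemma f_o_eq:
  assumes "Q \<in> SO" "norm y = 1"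
  shows "f_o y Q = 2 - 2 * (y \<bullet> (Q *v y))"
proof -
  have "f_o y Q = (norm (transpose Q *v y))\<^sup>2 + (norm y)\<^sup>2 - 2 * ((transpose Q *v y) \<bullet> y)"
    unfolding f_o_def by (simp add: power2_norm_eq_inner inner_diff inner_commute)
  then show ?thesis
    by (simp add: norm_transpose_SO[OF assms(1)] assms inner_transpose_mult)
qed

lemma inner_SO_bounds:
  assumes "Q \<in> SO" "norm y = 1"
  shows "\<bar>y \<bullet> (Q *v y)\<bar> \<le> 1"
  using Cauchy_Schwarz_ineq2[of y "Q *v y"] by (simp add: norm_SO assms)

text \<open>The equality case of Cauchy-Schwarz, read off from the squared norm of
  \<open>Q *v y + y\<close>.\<close>

lemma inner_SO_eq_minus_1_iff:
  assumes "Q \<in> SO" "norm y = 1"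
  shows "y \<bullet> (Q *v y) = -1 \<longleftrightarrow> Q *v y = - y"
proof -
  have "(norm (Q *v y + y))\<^sup>2 = 2 + 2 * (y \<bullet> (Q *v y))"
    using norm_SO[OF assms(1), of y] assms(2)
    by (simp add: power2_norm_eq_inner inner_add inner_commute norm_eq_1)
  then have "y \<bullet> (Q *v y) = -1 \<longleftrightarrow> norm (Q *v y + y) = 0"
    by (auto simp: algebra_simps)
  then show ?thesis
    by (simp add: eq_neg_iff_add_eq_0)
qed

lemma exists_SO_mapping:
  fixes x y :: "real^'n"
  assumes "2 \<le> CARD('n)" "norm x = norm y"
  obtains Q where "Q \<in> SO" "Q *v x = y"
proof -
  obtain f where f: "orthogonal_transformation f" "det (matrix f) = 1" "f x = y"
    using rotation_exists[OF assms] by blast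
  have lin: "linear f"
    using f(1) by (simp add: orthogonal_transformation_def)
  show thesis
    using f lin that[of "matrix f"]
    by (auto simp: SO_def rotation_matrix_def orthogonal_transformation_matrix matrix_works)
qed

text \<open>The cost is at most 4, with equality exactly when the cosine is -1. In dimension at
  least two some rotation takes \<open>y\<close> to \<open>- y\<close>, so 4 is attained.\<close>

lemma Z_y_eq:
  fixes y :: "real^'n"
  assumes "2 \<le> CARD('n)" "norm y = 1"
  shows "Z_y y = {Q \<in> SO. \<forall>P\<in>SO. f_o y P \<le> f_o y Q}"
proof -
  obtain P where P: "P \<in> SO" "P *v y = - y"
    using exists_SO_mapping[OF assms(1), of y "- y"] by auto
  then have "f_o y P = 4"
    using assms(2) by (simp add: f_o_eq norm_eq_1)
  moreover have "f_o y Q \<le> 4" if "Q \<in> SO" for Q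
    using inner_SO_bounds[OF that assms(2)] by (simp add: f_o_eq that assms)
  moreover have "f_o y Q = 4 \<longleftrightarrow> Q *v y = - y" if "Q \<in> SO" for Q
    using inner_SO_eq_minus_1_iff[OF that assms(2)] by (auto simp: f_o_eq that assms)
  ultimately show ?thesis
    using P(1) unfolding Z_y_def by (metis (no_types, lifting) order_antisym order_refl)
qed

subsection \<open>Constant reference direction\<close>

lemma cosh_sinh_pos:
  fixes c t :: real
  assumes "\<bar>c\<bar> \<le> 1" "t \<ge> 0"
  shows "cosh t + c * sinh t > 0"
proof -
  have "\<bar>c * sinh t\<bar> \<le> 1 * sinh t"
    using assms mult_right_mono[of "\<bar>c\<bar>" 1 "sinh t"] by (simp add: abs_mult)
  then show ?thesis
    using sinh_less_cosh_real[of t] by linarith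
qed

section \<open>Closed-form solution for constant \<open>y\<close>\<close>

locale constant_reference =
  fixes y :: "real^'n" and Q :: "real \<Rightarrow> real^'n^'n"
  assumes norm_y: "norm y = 1" and traj: "trajectory (\<lambda>_. y) 0 Q"
begin

definition c0 where "c0 = y \<bullet> (Q 0 *v y)"
text \<open>\<open>p\<close> and \<open>q\<close> are the components orthogonal to \<open>y\<close>
  of two unit vectors that have the same cosine \<open>c0\<close> with \<open>y\<close>.\<close>

definition p where "p = Q 0 *v y - c0 *\<^sub>R y"
definition q where "q = transpose (Q 0) *v y - c0 *\<^sub>R y"
definition D where "D t = cosh t + c0 * sinh t" for t :: real
definition D' where "D' t = sinh t + c0 * cosh t" for t :: real

lemma yy: "y \<bullet> y = 1"
  using norm_y by (simp add: norm_eq_1)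

lemma in_SO: "t \<ge> 0 \<Longrightarrow> Q t \<in> SO"
  using trajectory_in_SO[OF traj] .

lemma c0_bounds: "\<bar>c0\<bar> \<le> 1"
  unfolding c0_def by (rule inner_SO_bounds[OF in_SO norm_y]) simp

lemma D_pos: "t \<ge> 0 \<Longrightarrow> D t > 0"
  unfolding D_def by (rule cosh_sinh_pos[OF c0_bounds])

lemma D_derivative: "(D has_real_derivative D' t) (at t within S)"
  "(D' has_real_derivative D t) (at t within S)"
  unfolding D_def[abs_def] D'_def[abs_def] by (auto intro!: derivative_eq_intros)

text \<open>The conserved energy of \<open>D'' = D\<close>. It turns
  \<open>1 - (D' t / D t)\<^sup>2\<close> into \<open>(1 - c0\<^sup>2) / (D t)\<^sup>2\<close> when
  \<open>Q\<close> is integrated.\<close>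

lemma D_identity: "(D t)\<^sup>2 - (D' t)\<^sup>2 = 1 - c0\<^sup>2"
proof -
  have "(D t)\<^sup>2 - (D' t)\<^sup>2 = (1 - c0\<^sup>2) * ((cosh t)\<^sup>2 - (sinh t)\<^sup>2)"
    by (simp add: D_def D'_def power2_eq_square algebra_simps)
  then show ?thesis
    by (simp add: cosh_square_eq)
qed

lemma cosine_derivative:
  assumes "t \<ge> 0"
  shows "((\<lambda>t. y \<bullet> (Q t *v y)) has_real_derivative 1 - (y \<bullet> (Q t *v y))\<^sup>2) (at t within {0..})"
proof -
  have "bounded_linear (\<lambda>A. y \<bullet> (A *v y))"
    using bounded_linear_compose[OF bounded_linear_inner_right bounded_linear_matrix_vector_mult_left] .
  from bounded_linear.has_vector_derivative[OF this trajectory_derivative[OF traj assms]]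
  show ?thesis
    by (simp add: has_real_derivative_iff_has_vector_derivative matrix_vector_mult_diff_rdistrib
        outer_vec inner_diff yy inner_transpose_mult power2_eq_square)
qed

text \<open>The cosine satisfies the Riccati equation, whose linearisation has solution \<open>D\<close>.\<close>
lemma cosine_eq:
  assumes "t \<ge> 0"
  shows "y \<bullet> (Q t *v y) = D' t / D t"
proof -
  define c where "c t = y \<bullet> (Q t *v y)" for t
  \<comment> \<open>\<open>w\<close> measures the failure of the claim and satisfies the linear
    equation \<open>w' = - c w\<close> with \<open>w 0 = 0\<close>.\<close>
  define w where "w t = D t * c t - D' t" for t
  have w_deriv: "(w has_real_derivative - (c t) * w t) (at t within {0..})" if "t \<ge> 0" for t
    unfolding w_def[abs_def] c_def
    by (rule derivative_eq_intros D_derivative cosine_derivative that refl)+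
      (simp add: algebra_simps power2_eq_square)
  \<comment> \<open>Since \<open>c \<ge> -1\<close>, the factor \<open>exp (- 2 * t)\<close> makes
    \<open>g\<close> nondecreasing. As \<open>g\<close> starts at 0 and is never positive,
    \<open>w\<close> vanishes.\<close>
  define g where "g t = - ((w t)\<^sup>2 * exp (- 2 * t))" for t
  have "(g has_vector_derivative 2 * (c t + 1) * ((w t)\<^sup>2 * exp (- 2 * t))) (at t within {0..})"
    if t: "t \<ge> 0" for t
    unfolding g_def[abs_def] has_real_derivative_iff_has_vector_derivative[symmetric]
    by (rule derivative_eq_intros w_deriv[OF t] refl)+ (simp add: algebra_simps power2_eq_square)
  moreover have "0 \<le> 2 * (c t + 1) * ((w t)\<^sup>2 * exp (- 2 * t))" if "t \<ge> 0" for t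
    using inner_SO_bounds[OF in_SO[OF that] norm_y] by (simp add: c_def)
  ultimately have "g 0 \<le> g t"
    by (rule mono_of_derivative_on_halfline) (use assms in auto)
  moreover have "w 0 = 0"
    by (simp add: w_def D_def D'_def c_def c0_def)
  ultimately have "w t = 0"
    by (simp add: g_def mult_le_0_iff)
  then show ?thesis
    using D_pos[OF assms] by (simp add: w_def c_def field_simps)
qed

text \<open>\<open>D\<close> is an integrating factor: because \<open>D' = c D\<close>, the vector
  \<open>D u - D' y\<close> is constant. Both \<open>Q y\<close> and its transposed counterpart
  solve this equation.\<close>

lemma vector_solution_eq:
  assumes u': "\<And>t. t \<ge> 0 \<Longrightarrow> (u has_vector_derivative y - (y \<bullet> (Q t *v y)) *\<^sub>R u t) (at t within {0..})"
    and t: "t \<ge> 0"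
  shows "u t = (D' t / D t) *\<^sub>R y + (1 / D t) *\<^sub>R (u 0 - c0 *\<^sub>R y)"
proof -
  have "((\<lambda>t. D t *\<^sub>R u t - D' t *\<^sub>R y) has_vector_derivative 0) (at t within {0..})"
    if "t \<ge> 0" for t
    by (rule derivative_eq_intros D_derivative u' that refl)+
      (use D_pos[OF that] in \<open>simp add: cosine_eq[OF that] algebra_simps\<close>)
  from constant_of_derivative_on_halfline[OF this t]
  have "D t *\<^sub>R u t = D' t *\<^sub>R y + (u 0 - c0 *\<^sub>R y)"
    by (simp add: D_def D'_def algebra_simps)
  then have "(1 / D t) *\<^sub>R (D t *\<^sub>R u t) = (1 / D t) *\<^sub>R (D' t *\<^sub>R y + (u 0 - c0 *\<^sub>R y))"
    by simp
  then show ?thesis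
    using D_pos[OF t] by (simp add: scaleR_add_right)
qed

lemma images_eq:
  assumes t: "t \<ge> 0"
  shows "Q t *v y = (D' t / D t) *\<^sub>R y + (1 / D t) *\<^sub>R p"
    and "transpose (Q t) *v y = (D' t / D t) *\<^sub>R y + (1 / D t) *\<^sub>R q"
proof -
  have "((\<lambda>t. Q t *v y) has_vector_derivative y - (y \<bullet> (Q t *v y)) *\<^sub>R (Q t *v y)) (at t within {0..})"
    if "t \<ge> 0" for t
    using bounded_linear.has_vector_derivative[OF bounded_linear_matrix_vector_mult_left
        trajectory_derivative[OF traj that], of y]
    by (simp add: matrix_vector_mult_diff_rdistrib outer_vec yy inner_transpose_mult)
  from vector_solution_eq[of "\<lambda>t. Q t *v y", OF this t]
  show "Q t *v y = (D' t / D t) *\<^sub>R y + (1 / D t) *\<^sub>R p"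
    by (simp add: p_def)
  have "((\<lambda>t. transpose (Q t) *v y) has_vector_derivative
      y - (y \<bullet> (Q t *v y)) *\<^sub>R (transpose (Q t) *v y)) (at t within {0..})"
    if "t \<ge> 0" for t
    using bounded_linear.has_vector_derivative[OF
        bounded_linear_compose[OF bounded_linear_matrix_vector_mult_left bounded_linear_transpose]
        trajectory_derivative[OF traj that], of y]
    by (simp add: transpose_diff transpose_outer matrix_vector_mult_diff_rdistrib outer_vec yy inner_commute)
  from vector_solution_eq[of "\<lambda>t. transpose (Q t) *v y", OF this t]
  show "transpose (Q t) *v y = (D' t / D t) *\<^sub>R y + (1 / D t) *\<^sub>R q"
    by (simp add: q_def)
qed

text \<open>\<open>A\<close> and \<open>B\<close> are the constant matrices in the derivative of
  \<open>Q\<close>, which is \<open>A / D^2 - (D' / D^2) B\<close>.\<close>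

definition A where "A = (1 - c0\<^sup>2) *\<^sub>R outer y y - outer p q"
definition B where "B = outer y q + outer p y"
text \<open>For \<open>c0 \<noteq> -1\<close>, \<open>sinh t / D t\<close> tends to
  \<open>1 / (1 + c0)\<close> and \<open>1 / D t\<close> to 0 in the explicit solution.\<close>

definition limit where "limit = Q 0 + (1 / (1 + c0)) *\<^sub>R A - B"

text \<open>\<open>sinh / D\<close> and \<open>1 / D\<close> are antiderivatives of the coefficients
  of \<open>A\<close> and \<open>B\<close>, so subtracting these terms from \<open>Q\<close> leaves
  a constant.\<close>

lemma explicit_solution:
  assumes "t \<ge> 0"
  shows "Q t = Q 0 + (sinh t / D t) *\<^sub>R A + (1 / D t - 1) *\<^sub>R B"
proof -
  define R where "R t = Q t - (sinh t / D t) *\<^sub>R A - (1 / D t) *\<^sub>R B" for t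
  have "(R has_vector_derivative 0) (at t within {0..})" if t: "t \<ge> 0" for t
  proof -
    have D: "D t \<noteq> 0" using D_pos[OF t] by simp
    have "cosh t * D t - sinh t * D' t = (cosh t)\<^sup>2 - (sinh t)\<^sup>2"
      by (simp add: D_def D'_def power2_eq_square algebra_simps)
    then have *: "cosh t * D t - sinh t * D' t = 1"
      by (simp add: cosh_square_eq)
    have d1: "((\<lambda>t. sinh t / D t) has_real_derivative 1 / (D t)\<^sup>2) (at t within {0..})"
      by (rule derivative_eq_intros D_derivative D refl)+ (use * in \<open>simp add: power2_eq_square\<close>)
    have d2: "((\<lambda>t. 1 / D t) has_real_derivative - (D' t / (D t)\<^sup>2)) (at t within {0..})"
      by (rule derivative_eq_intros D_derivative D refl)+ (simp add: power2_eq_square)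
    have d3: "1 - (D' t / D t)\<^sup>2 = (1 - c0\<^sup>2) / (D t)\<^sup>2"
      using D_identity[of t] D by (simp add: field_simps)
    have "outer y y - outer (Q t *v y) (transpose (Q t) *v y)
        = (1 - (D' t / D t)\<^sup>2) *\<^sub>R outer y y - (1 / (D t)\<^sup>2) *\<^sub>R outer p q - (D' t / (D t)\<^sup>2) *\<^sub>R B"
      unfolding images_eq[OF t] B_def
      by (simp add: outer_linear algebra_simps power2_eq_square)
    also have "\<dots> = (1 / (D t)\<^sup>2) *\<^sub>R A - (D' t / (D t)\<^sup>2) *\<^sub>R B"
      unfolding d3 A_def by (simp add: scaleR_diff_right)
    finally have Q': "(Q has_vector_derivative (1 / (D t)\<^sup>2) *\<^sub>R A - (D' t / (D t)\<^sup>2) *\<^sub>R B)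
        (at t within {0..})"
      using trajectory_derivative[OF traj t] by simp
    show ?thesis
      unfolding R_def[abs_def]
      by (rule derivative_eq_intros d1 d2 Q' refl)+ simp
  qed
  from constant_of_derivative_on_halfline[OF this assms] show ?thesis
    by (simp add: R_def D_def algebra_simps)
qed

text \<open>The exponential appears because \<open>D t - (1 + c0) * sinh t\<close> equals
  \<open>cosh t - sinh t\<close>.\<close>

lemma distance_to_limit_eq:
  assumes "t \<ge> 0" "c0 \<noteq> -1"
  shows "limit - Q t = (exp (-t) / (D t * (1 + c0))) *\<^sub>R A - (1 / D t) *\<^sub>R B"
proof -
  have "1 + c0 \<noteq> 0"
    using assms(2) by linarith
  then have "1 / (1 + c0) - sinh t / D t = (D t - sinh t * (1 + c0)) / (D t * (1 + c0))"
    using D_pos[OF assms(1)] by (simp add: field_simps)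
  also have "D t - sinh t * (1 + c0) = exp (-t)"
    by (simp add: D_def algebra_simps flip: cosh_minus_sinh)
  finally have "(exp (-t) / (D t * (1 + c0))) *\<^sub>R A = (1 / (1 + c0)) *\<^sub>R A - (sinh t / D t) *\<^sub>R A"
    by (metis scaleR_left_diff_distrib)
  then show ?thesis
    unfolding limit_def explicit_solution[OF assms(1)] by (simp add: algebra_simps)
qed

lemma D_lower_bound:
  assumes "t \<ge> 0"
  shows "(1 + c0) / 2 * exp t \<le> D t"
proof -
  have "D t = (1 + c0) / 2 * exp t + (1 - c0) / 2 * exp (-t)"
    by (simp add: D_def cosh_field_def sinh_field_def field_simps)
  then show ?thesis
    using c0_bounds by (simp add: abs_le_iff)
qed

lemma norm_pq: "(norm p)\<^sup>2 = 1 - c0\<^sup>2" "(norm q)\<^sup>2 = 1 - c0\<^sup>2"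
  "p \<bullet> y = 0" "q \<bullet> y = 0"
proof -
  have *: "(norm (x - c0 *\<^sub>R y))\<^sup>2 = 1 - c0\<^sup>2 \<and> (x - c0 *\<^sub>R y) \<bullet> y = 0"
    if "norm x = 1" "x \<bullet> y = c0" for x
    using that unfolding power2_norm_eq_inner
    by (simp add: inner_diff yy inner_commute[of y x] power2_eq_square norm_eq_1)
  show "(norm p)\<^sup>2 = 1 - c0\<^sup>2" "p \<bullet> y = 0"
    using *[of "Q 0 *v y"] norm_SO[OF in_SO, of 0 y] norm_y
    by (simp_all add: p_def c0_def inner_commute)
  show "(norm q)\<^sup>2 = 1 - c0\<^sup>2" "q \<bullet> y = 0"
    using *[of "transpose (Q 0) *v y"] norm_transpose_SO[OF in_SO, of 0 y] norm_y
    by (simp_all add: q_def c0_def inner_transpose_mult)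
qed

text \<open>\<open>A\<close> is quadratic and \<open>B\<close> linear in the size of
  \<open>p\<close>, and \<open>1 / D\<close> decays like \<open>exp (-t)\<close>. The factor
  \<open>norm p\<close> is kept so that the bound can later be made proportional to the initial
  distance.\<close>

lemma distance_to_limit_le:
  assumes "t \<ge> 0" "c0 \<noteq> -1"
  shows "norm (Q t - limit) \<le> 12 / (1 + c0)\<^sup>2 * exp (-t) * norm p"
proof -
  have c0: "0 < 1 + c0" "1 + c0 \<le> 2"
    using c0_bounds assms(2) by (auto simp: abs_le_iff)
  have pq: "norm q = norm p"
    using norm_pq by (metis norm_ge_zero power2_eq_imp_eq)
  have p1: "norm p \<le> 1"
    by (rule power2_le_imp_le) (simp_all add: norm_pq(1))
  have "norm A \<le> norm ((1 - c0\<^sup>2) *\<^sub>R outer y y) + norm (outer p q)"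
    unfolding A_def by (rule norm_triangle_ineq4)
  also have "\<dots> = 2 * (norm p)\<^sup>2"
    unfolding norm_pq(1)[symmetric] by (simp add: norm_outer norm_y pq power2_eq_square)
  also have "\<dots> \<le> 2 * norm p"
    using p1 by (simp add: power2_eq_square mult_left_le)
  finally have A: "norm A \<le> 2 * norm p" .
  have B: "norm B \<le> 2 * norm p"
    unfolding B_def by (rule order_trans[OF norm_triangle_ineq]) (simp add: norm_outer norm_y pq)
  have "inverse (D t) \<le> inverse ((1 + c0) / 2 * exp t)"
    using D_lower_bound[OF assms(1)] c0 by (intro le_imp_inverse_le) auto
  also have "\<dots> = 2 / (1 + c0) * exp (-t)"
    unfolding exp_minus divide_inverse inverse_mult_distrib by simp
  finally have D: "1 / D t \<le> 2 / (1 + c0) * exp (-t)"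
    by (simp only: inverse_eq_divide)
  have "norm (Q t - limit) \<le> norm ((exp (-t) / (D t * (1 + c0))) *\<^sub>R A) + norm ((1 / D t) *\<^sub>R B)"
    unfolding norm_minus_commute[of "Q t"] distance_to_limit_eq[OF assms] by (rule norm_triangle_ineq4)
  also have "\<dots> = (1 / D t) * (exp (-t) / (1 + c0) * norm A + norm B)"
    using D_pos[OF assms(1)] c0 by (simp add: add_divide_distrib mult.commute)
  also have "\<dots> \<le> (2 / (1 + c0) * exp (-t)) * (1 / (1 + c0) * (2 * norm p) + 2 * norm p)"
  proof (rule mult_mono[OF D add_mono[OF mult_mono B]])
    show "exp (-t) / (1 + c0) \<le> 1 / (1 + c0)"
      using c0 assms(1) by (intro divide_right_mono) auto
  qed (use A c0 in \<open>auto intro!: add_nonneg_nonneg\<close>)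
  also have "\<dots> = (4 + 4 * (1 + c0)) / (1 + c0)\<^sup>2 * (exp (-t) * norm p)"
  proof -
    have "2 / r * e * (1 / r * (2 * x) + 2 * x) = (4 + 4 * r) / r\<^sup>2 * (e * x)"
      if "r > 0" for r e x :: real
      using that by (simp add: field_simps power2_eq_square)
    from this[OF c0(1)] show ?thesis .
  qed
  \<comment> \<open>The constant 12 is the value of \<open>4 + 4 * (1 + c0)\<close> at the largest
    possible \<open>1 + c0 = 2\<close>.\<close>
  also have "\<dots> \<le> 12 / (1 + c0)\<^sup>2 * (exp (-t) * norm p)"
    using c0 by (intro mult_right_mono divide_right_mono) auto
  finally show ?thesis
    by (simp add: mult.assoc)
qed

end

text \<open>Each \<open>P\<close> in \<open>C_o y\<close> fixes \<open>y\<close>, so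
  \<open>Q *v y - y\<close> is \<open>(Q - P) *v y\<close>.\<close>

lemma infdist_C_o_ge:
  assumes "norm y = 1"
  shows "norm (Q *v y - y) \<le> infdist Q (C_o y)"
proof -
  \<comment> \<open>Nonemptiness matters: \<open>infdist\<close> to the empty set is 0 by
    convention.\<close>
  have "mat 1 \<in> C_o y"
    by (simp add: C_o_alt mat_1_in_SO)
  moreover have "norm (Q *v y - y) \<le> dist Q P" if "P \<in> C_o y" for P
    using norm_matrix_vector_mult_le[of "Q - P" y] that assms
    by (simp add: C_o_alt dist_norm matrix_vector_mult_diff_rdistrib)
  ultimately show ?thesis
    unfolding infdist_def by (auto intro!: cINF_greatest)
qed

section \<open>Convergence to \<open>C_o\<close> and the initial points that reach the
  identity\<close>

context constant_reference
begin

lemma c0_eq_minus_1_iff: "c0 = -1 \<longleftrightarrow> Q 0 \<in> Z_y y"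
  using inner_SO_eq_minus_1_iff[OF in_SO norm_y, of 0] in_SO[of 0] by (auto simp: Z_y_def c0_def)

lemma tendsto_limit:
  assumes "c0 \<noteq> -1"
  shows "(Q \<longlongrightarrow> limit) at_top"
proof (rule LIM_zero_cancel, rule Lim_null_comparison)
  show "\<forall>\<^sub>F t in at_top. norm (Q t - limit) \<le> 12 / (1 + c0)\<^sup>2 * exp (-t) * norm p"
    using eventually_ge_at_top[of 0] by eventually_elim (rule distance_to_limit_le[OF _ assms])
  have "((\<lambda>t. 12 / (1 + c0)\<^sup>2 * exp (-t) * norm p) \<longlongrightarrow> 12 / (1 + c0)\<^sup>2 * 0 * norm p) at_top"
    by (intro tendsto_intros filterlim_compose[OF exp_at_bot filterlim_uminus_at_bot_at_top])
  then show "((\<lambda>t. 12 / (1 + c0)\<^sup>2 * exp (-t) * norm p) \<longlongrightarrow> 0) at_top"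
    by simp
qed

lemma one_minus_c0_square: "c0 \<noteq> -1 \<Longrightarrow> (1 - c0\<^sup>2) / (1 + c0) = 1 - c0"
proof -
  assume "c0 \<noteq> -1"
  then have "1 + c0 \<noteq> 0" by linarith
  then show ?thesis
    by (simp add: divide_eq_eq) (simp add: power2_eq_square algebra_simps)
qed

text \<open>\<open>SO\<close> is closed, and \<open>A *v y\<close> and \<open>B *v y\<close> are
  explicit, which shows that the limit fixes \<open>y\<close>.\<close>

lemma limit_in_C_o:
  assumes "c0 \<noteq> -1"
  shows "limit \<in> C_o y"
proof -
  have "limit \<in> SO"
    using eventually_mono[OF eventually_ge_at_top[of 0] in_SO]
    by (intro Lim_in_closed_set[OF closed_SO _ _ tendsto_limit[OF assms]]) auto
  moreover have "limit *v y = y"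
  proof -
    have "(1 / (1 + c0)) *\<^sub>R ((1 - c0\<^sup>2) *\<^sub>R y) = (1 - c0) *\<^sub>R y"
      by (simp add: one_minus_c0_square[OF assms])
    moreover have "A *v y = (1 - c0\<^sup>2) *\<^sub>R y" "B *v y = p"
      by (simp_all add: A_def B_def matrix_vector_mult_diff_rdistrib matrix_vector_mult_add_rdistrib
          outer_vec yy norm_pq(4) flip: scaleR_matrix_vector_assoc)
    ultimately have "limit *v y = Q 0 *v y + (1 - c0) *\<^sub>R y - p"
      by (simp add: limit_def matrix_vector_mult_diff_rdistrib matrix_vector_mult_add_rdistrib
          flip: scaleR_matrix_vector_assoc)
    then show ?thesis
      by (simp add: p_def algebra_simps)
  qed
  ultimately show ?thesis
    by (simp add: C_o_alt)
qed

lemma infdist_C_o_le: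
  assumes "t \<ge> 0" "c0 \<noteq> -1"
  shows "infdist (Q t) (C_o y) \<le> 12 / (1 + c0)\<^sup>2 * exp (-t) * norm p"
  using infdist_le[OF limit_in_C_o[OF assms(2)], of "Q t"] distance_to_limit_le[OF assms]
  by (simp add: dist_norm)

lemma converges_to_C_o:
  assumes "c0 \<noteq> -1"
  shows "converges_to Q (C_o y)"
  using tendsto_infdist[OF tendsto_limit[OF assms], of "C_o y"] limit_in_C_o[OF assms]
  by (simp add: converges_to_def)

text \<open>Starting within distance 1 makes the cosine \<open>c0\<close> nonnegative, so
  \<open>(1 + c0)\<^sup>2 \<ge> 1\<close>. Moreover \<open>norm p\<close> is at most
  \<open>norm (Q 0 *v y - y)\<close>, hence at most the initial distance.\<close>

lemma infdist_C_o_exponential: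
  assumes "infdist (Q 0) (C_o y) < 1" "t \<ge> 0"
  shows "infdist (Q t) (C_o y) \<le> 12 * exp (-t) * infdist (Q 0) (C_o y)"
proof -
  have d: "(norm (Q 0 *v y - y))\<^sup>2 = 2 * (1 - c0)"
    using norm_SO[OF in_SO, of 0 y] norm_y
    by (simp add: power2_norm_eq_inner inner_diff inner_commute c0_def norm_eq_1)
  have le: "norm (Q 0 *v y - y) \<le> infdist (Q 0) (C_o y)"
    by (rule infdist_C_o_ge[OF norm_y])
  then have "(norm (Q 0 *v y - y))\<^sup>2 \<le> 1"
    using assms(1) by (simp add: power_le_one)
  then have c0: "c0 \<ge> 0"
    unfolding d by simp
  have "(norm p)\<^sup>2 = (1 + c0) * (1 - c0)"
    using norm_pq(1) by (simp add: power2_eq_square algebra_simps)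
  also have "\<dots> \<le> 2 * (1 - c0)"
    using c0_bounds by (intro mult_right_mono) (auto simp: abs_le_iff)
  finally have "(norm p)\<^sup>2 \<le> (norm (Q 0 *v y - y))\<^sup>2"
    unfolding d .
  then have p: "norm p \<le> norm (Q 0 *v y - y)"
    by (rule power2_le_imp_le) simp
  have "1 \<le> (1 + c0)\<^sup>2"
    using c0 by (intro one_le_power) simp
  then have "12 / (1 + c0)\<^sup>2 \<le> 12 / 1"
    by (intro divide_left_mono) auto
  then have "12 / (1 + c0)\<^sup>2 \<le> 12"
    by simp
  have "infdist (Q t) (C_o y) \<le> 12 / (1 + c0)\<^sup>2 * exp (-t) * norm p"
    using c0 by (intro infdist_C_o_le assms) simp
  also have "\<dots> \<le> 12 * exp (-t) * infdist (Q 0) (C_o y)"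
    using p le \<open>12 / (1 + c0)\<^sup>2 \<le> 12\<close> by (intro mult_mono) auto
  finally show ?thesis .
qed

text \<open>For a rotation in the plane of \<open>y\<close> and \<open>z\<close>, \<open>p\<close>
  and \<open>q\<close> are opposite multiples of \<open>z\<close>, and the closed expression for the
  limit collapses to the identity.\<close>

lemma S_0_imp_tendsto:
  assumes "Q 0 \<in> S_0 y"
  shows "(Q \<longlongrightarrow> mat 1) at_top"
proof -
  obtain z \<theta> where z: "norm z = 1" "z \<bullet> y = 0" and \<theta>: "-pi < \<theta>" "\<theta> < pi"
    and Q0: "Q 0 = mat 1 + (cos \<theta> - 1) *\<^sub>R (outer y y + outer z z) + sin \<theta> *\<^sub>R (outer y z - outer z y)"
    using assms by (auto simp: S_0_def)
  have "Q 0 *v y = cos \<theta> *\<^sub>R y - sin \<theta> *\<^sub>R z"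
    unfolding Q0 by (simp add: matrix_vector_mult_diff_rdistrib matrix_vector_mult_add_rdistrib
        outer_vec z yy algebra_simps flip: scaleR_matrix_vector_assoc)
  moreover have "transpose (Q 0) *v y = cos \<theta> *\<^sub>R y + sin \<theta> *\<^sub>R z"
    unfolding Q0 by (simp add: transpose_diff transpose_add transpose_scaleR transpose_outer
        transpose_mat matrix_vector_mult_diff_rdistrib matrix_vector_mult_add_rdistrib
        outer_vec z yy algebra_simps flip: scaleR_matrix_vector_assoc)
  ultimately have c0: "c0 = cos \<theta>" and p: "p = - sin \<theta> *\<^sub>R z" and q: "q = sin \<theta> *\<^sub>R z"
    using z(2) by (simp_all add: c0_def p_def q_def inner_diff yy inner_commute)
  \<comment> \<open>The open interval for \<theta> excludes the half turn and thus keeps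
    \<open>Q 0\<close> out of \<open>Z_y y\<close>.\<close>
  have "cos \<bar>\<theta>\<bar> > cos pi"
    using \<theta> by (intro cos_monotone_0_pi) auto
  then have ne: "c0 \<noteq> -1"
    by (auto simp: c0)
  have "A = (1 - (cos \<theta>)\<^sup>2) *\<^sub>R (outer y y + outer z z)"
    by (simp add: A_def p q c0 outer_linear scaleR_add_right sin_squared_eq flip: power2_eq_square)
  then have "(1 / (1 + c0)) *\<^sub>R A = (1 - cos \<theta>) *\<^sub>R (outer y y + outer z z)"
    using one_minus_c0_square[OF ne] by (simp add: c0)
  then have "limit = mat 1"
    unfolding limit_def B_def p q Q0 by (simp add: outer_linear algebra_simps)
  then show ?thesis
    using tendsto_limit[OF ne] by simp
qed

text \<open>Solving \<open>limit = mat 1\<close> expresses \<open>Q 0\<close> through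
  \<open>p\<close> and \<open>q\<close>. Since \<open>y\<close> and \<open>p\<close> are orthogonal,
  so are their images under \<open>Q 0\<close>; this forces
  \<open>p \<bullet> q = - (p \<bullet> p)\<close>, and equal norms then give
  \<open>q = - p\<close>.\<close>

lemma limit_eq_mat_1_imp_S_0:
  assumes "2 \<le> CARD('n)" "c0 \<noteq> -1" "limit = mat 1"
  shows "Q 0 \<in> S_0 y"
proof -
  have c0: "c0 > -1"
    using assms(2) c0_bounds by (auto simp: abs_le_iff)
  define k where "k = p \<bullet> q"
  have Q0: "Q 0 = mat 1 - (1 / (1 + c0)) *\<^sub>R A + B"
    using assms(3) by (simp add: limit_def algebra_simps)
  have yp: "y \<bullet> p = 0" "y \<bullet> q = 0"
    using norm_pq(3,4) by (simp_all add: inner_commute)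
  have "Q 0 *v p = p + (k / (1 + c0)) *\<^sub>R p + k *\<^sub>R y"
    unfolding Q0 A_def B_def
    by (simp add: matrix_vector_mult_diff_rdistrib matrix_vector_mult_add_rdistrib
        outer_vec yp inner_commute[of q p] flip: scaleR_matrix_vector_assoc k_def)
  moreover have "Q 0 *v y = c0 *\<^sub>R y + p"
    by (simp add: p_def)
  ultimately have "(c0 *\<^sub>R y + p) \<bullet> (p + (k / (1 + c0)) *\<^sub>R p + k *\<^sub>R y) = 0"
    using inner_SO[OF in_SO, of 0 y p] yp by simp
  then have "c0 * k + (p \<bullet> p) * (1 + k / (1 + c0)) = 0"
    by (simp add: inner_add yy yp norm_pq(3) algebra_simps)
  moreover have pp: "p \<bullet> p = (1 + c0) * (1 - c0)"
    using norm_pq(1) unfolding power2_norm_eq_inner by (simp add: power2_eq_square algebra_simps)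
  moreover have "(1 + c0) * (1 - c0) * (1 + k / (1 + c0)) = (1 - c0) * (1 + c0 + k)"
    using c0 by (simp add: field_simps)
  ultimately have "c0 * k + (1 - c0) * (1 + c0 + k) = 0"
    by metis
  then have k: "k = - (p \<bullet> p)"
    by (simp add: pp algebra_simps)
  have "(norm (p + q))\<^sup>2 = 0"
    using norm_pq(1,2) k by (simp add: power2_norm_eq_inner inner_add inner_commute k_def)
  then have q: "q = - p"
    by (simp add: eq_neg_iff_add_eq_0 add.commute)
  show ?thesis
  proof (cases "p = 0")
    \<comment> \<open>Here \<open>Q 0\<close> is the identity, so any unit vector orthogonal to
      \<open>y\<close> serves, with angle 0.\<close>
    case True
    obtain z where "z \<noteq> 0" "orthogonal y z"
      using orthogonal_to_vector_exists[of y] assms(1) by auto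
    then have "sgn z \<in> sphere 0 1" "sgn z \<bullet> y = 0"
      by (auto simp: norm_sgn sgn_div_norm orthogonal_def inner_commute)
    moreover have "c0 = 1"
      using pp True c0 by auto
    with True q have "Q 0 = mat 1"
      by (simp add: Q0 A_def B_def outer_linear)
    ultimately show ?thesis
      unfolding S_0_def by (auto intro!: exI[of _ "sgn z"] exI[of _ "0::real"])
  next
    case False
    \<comment> \<open>With the arccosine the sine is \<open>norm p\<close>, and
      \<open>p = - sin \<theta> *\<^sub>R z\<close> then dictates the sign of
      \<open>z\<close>.\<close>
    define \<theta> where "\<theta> = arccos c0"
    define z where "z = - (1 / norm p) *\<^sub>R p"
    have cos: "cos \<theta> = c0"
      using c0_bounds by (simp add: \<theta>_def cos_arccos_abs)
    have sin: "sin \<theta> = norm p"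
      using c0_bounds norm_pq(1) by (simp add: \<theta>_def sin_arccos_abs flip: norm_pq(1))
    have "c0 \<noteq> 1"
      using pp False by auto
    then have "\<theta> \<in> {-pi<..<pi}"
      using arccos_lt_bounded[of c0] c0 c0_bounds pi_gt_zero by (auto simp: \<theta>_def abs_le_iff)
    moreover have "z \<in> sphere 0 1" "z \<bullet> y = 0"
      using False norm_pq(3) by (auto simp: z_def)
    moreover have "Q 0 = mat 1 + (cos \<theta> - 1) *\<^sub>R (outer y y + outer z z)
        + sin \<theta> *\<^sub>R (outer y z - outer z y)"
    proof -
      have "(c0 - 1) / (p \<bullet> p) = - ((1 - c0) / ((1 + c0) * (1 - c0)))"
        unfolding pp by (metis minus_diff_eq minus_divide_left)
      also have "\<dots> = - (1 / (1 + c0))"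
        using \<open>c0 \<noteq> 1\<close> by simp
      finally have "(c0 - 1) / (p \<bullet> p) = - (1 / (1 + c0))" .
      then have zz: "(c0 - 1) *\<^sub>R outer z z = - (1 / (1 + c0)) *\<^sub>R outer p p"
        by (simp add: z_def outer_linear power_divide power2_norm_eq_inner flip: power2_eq_square)
      have yz: "norm p *\<^sub>R outer y z = - outer y p" "norm p *\<^sub>R outer z y = - outer p y"
        using False by (simp_all add: z_def outer_linear)
      have "(1 / (1 + c0)) *\<^sub>R ((1 - c0\<^sup>2) *\<^sub>R outer y y) = (1 - c0) *\<^sub>R outer y y"
        by (simp add: one_minus_c0_square[OF assms(2)])
      then have "(1 / (1 + c0)) *\<^sub>R A = (1 - c0) *\<^sub>R outer y y + (1 / (1 + c0)) *\<^sub>R outer p p"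
        unfolding A_def q by (simp add: scaleR_add_right outer_linear)
      then show ?thesis
        unfolding Q0 cos sin scaleR_add_right scaleR_diff_right zz yz B_def q
        by (simp add: outer_linear algebra_simps)
    qed
    ultimately show ?thesis
      unfolding S_0_def by blast
  qed
qed

lemma tendsto_mat_1_imp_S_0:
  assumes "2 \<le> CARD('n)" "(Q \<longlongrightarrow> mat 1) at_top"
  shows "Q 0 \<in> S_0 y"
proof -
  have "c0 \<noteq> -1"
  proof
    \<comment> \<open>From such a start the cosine is -1 for all time, while at the identity it is
      1.\<close>
    assume c0: "c0 = -1"
    have "\<forall>\<^sub>F t in at_top. y \<bullet> (Q t *v y) = -1"
      using eventually_ge_at_top[of "0::real"]
    proof eventually_elim
      case (elim t)
      have "D' t = - D t"
        by (simp add: D_def D'_def c0)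
      then show ?case
        using cosine_eq[OF elim] D_pos[OF elim] by simp
    qed
    then have "((\<lambda>t. y \<bullet> (Q t *v y)) \<longlongrightarrow> -1) at_top"
      by (rule tendsto_eventually)
    moreover have "((\<lambda>t. y \<bullet> (Q t *v y)) \<longlongrightarrow> y \<bullet> (mat 1 *v y)) at_top"
      using assms(2) by (intro tendsto_intros bounded_linear.tendsto[OF bounded_linear_matrix_vector_mult_left])
    ultimately have "-1 = y \<bullet> (mat 1 *v y)"
      by (rule tendsto_unique[OF trivial_limit_at_top_linorder])
    then show False
      by (simp add: yy)
  qed
  moreover from this have "limit = mat 1"
    using tendsto_limit assms(2) tendsto_unique trivial_limit_at_top_linorder by blast
  ultimately show ?thesis
    using limit_eq_mat_1_imp_S_0[OF assms(1)] by blast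
qed

end

subsection \<open>Global existence for Lipschitz fields\<close>

lemma integral_has_vector_derivative_halfline:
  fixes k :: "real \<Rightarrow> 'a::banach"
  assumes "continuous_on {t0..} k" "t0 \<le> t"
  shows "((\<lambda>u. integral {t0..u} k) has_vector_derivative k t) (at t within {t0..})"
proof -
  have "((\<lambda>u. integral {t0..u} k) has_vector_derivative k t) (at t within {t0..t+1})"
    using assms by (intro integral_has_vector_derivative) (auto intro: continuous_on_subset)
  \<comment> \<open>The end point \<open>t+1\<close> leaves room to the right of \<open>t\<close>,
    so both filters agree near \<open>t\<close>.\<close>
  also have "at t within {t0..t+1} = at t within {t0..}"
    by (rule at_within_nhd[of _ "{..<t+1}"]) auto
  finally show ?thesis .
qed

text \<open>In the sup norm weighted by \<open>exp (- 2 * L * t)\<close> the Picard operator halves distances,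
  which gives the solution on the whole half-line at once.\<close>
theorem global_solution_exists:
  fixes f :: "real \<Rightarrow> 'a::banach \<Rightarrow> 'a"
  assumes cont: "\<And>g. continuous_on {t0..} g \<Longrightarrow> continuous_on {t0..} (\<lambda>t. f t (g t))"
    and lip: "\<And>t x z. t \<ge> t0 \<Longrightarrow> norm (f t x - f t z) \<le> L * norm (x - z)"
    and bdd: "\<And>t x. t \<ge> t0 \<Longrightarrow> norm (f t x) \<le> B"
    and "L > 0"
  obtains x where "x t0 = x0"
    "\<And>t. t \<ge> t0 \<Longrightarrow> (x has_vector_derivative f t (x t)) (at t within {t0..})"
proof -
  define e where "e t = exp (2 * L * (t - t0))" for t
  have e_pos: "e t > 0" for t
    by (simp add: e_def)
  define F where "F g t = x0 + integral {t0..t} (\<lambda>s. f s (e s *\<^sub>R g s))" for g :: "real \<Rightarrow> 'a" and t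
  \<comment> \<open>\<open>g\<close> stands for the solution divided by the weight. Freezing the
    time at \<open>t0\<close> to the left of it gives a function on the whole line, as the type of
    bounded continuous functions requires.\<close>
  define \<Phi> where "\<Phi> g t = (1 / e (max t0 t)) *\<^sub>R F g (max t0 t)" for g t
  have F': "(F g has_vector_derivative f t (e t *\<^sub>R g t)) (at t within {t0..})"
    if "continuous_on UNIV g" "t \<ge> t0" for g t
  proof -
    have "continuous_on {t0..} (\<lambda>s. e s *\<^sub>R g s)"
      unfolding e_def by (intro continuous_intros continuous_on_subset[OF that(1)]) auto
    from integral_has_vector_derivative_halfline[OF cont[OF this] that(2)]
    show ?thesis
      unfolding F_def[abs_def] by (auto intro!: derivative_eq_intros)
  qed
  have F_t0: "F g t0 = x0" for g
    by (simp add: F_def)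
  have B: "B \<ge> 0"
    using order_trans[OF norm_ge_zero bdd[of t0]] by simp
  have \<Phi>: "\<Phi> g \<in> bcontfun" if g: "continuous_on UNIV g" for g
  proof -
    have "continuous_on {t0..} (F g)"
      using F'[OF g] by (auto simp: continuous_on_eq_continuous_within intro: has_vector_derivative_continuous)
    then have "continuous_on UNIV (\<lambda>t. F g (max t0 t))"
      by (rule continuous_on_compose2) (auto intro!: continuous_intros)
    then have "continuous_on UNIV (\<Phi> g)"
      unfolding \<Phi>_def[abs_def] e_def by (intro continuous_intros) auto
    moreover have "norm (\<Phi> g t) \<le> norm x0 + B / (2 * L)" for t
    proof -
      define s where "s = max t0 t"
      have s: "s \<ge> t0" by (simp add: s_def)
      have "norm (F g s - F g t0) \<le> B * s - B * t0"
      proof (rule norm_diff_le_of_derivative_on_halfline[OF F'[OF g], where g' = "\<lambda>_. B"])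
        show "((*) B has_vector_derivative B) (at t within {t0..})" for t
          unfolding has_real_derivative_iff_has_vector_derivative[symmetric]
          by (auto intro!: derivative_eq_intros)
      qed (use bdd s in auto)
      then have "norm (F g s) \<le> norm x0 + B * (s - t0)"
        using norm_triangle_sub[of "F g s" x0] by (simp add: F_t0 algebra_simps)
      also have "\<dots> \<le> e s * norm x0 + e s * (B / (2 * L))"
      proof (rule add_mono)
        have "1 \<le> e s"
          using s \<open>L > 0\<close> by (simp add: e_def)
        then show "norm x0 \<le> e s * norm x0"
          by (simp add: mult_le_cancel_right1)
        \<comment> \<open>The inequality \<open>x \<le> exp x\<close> absorbs the linear growth of
          the integral into the weight.\<close>
        have "2 * L * (s - t0) \<le> e s"
          using exp_ge_add_one_self[of "2 * L * (s - t0)"] unfolding e_def by linarith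
        then have "2 * L * (s - t0) * (B / (2 * L)) \<le> e s * (B / (2 * L))"
          using B \<open>L > 0\<close> by (intro mult_right_mono) auto
        moreover have "2 * L * (s - t0) * (B / (2 * L)) = B * (s - t0)"
          using \<open>L > 0\<close> by simp
        ultimately show "B * (s - t0) \<le> e s * (B / (2 * L))"
          by simp
      qed
      finally have "norm (F g s) / e s \<le> norm x0 + B / (2 * L)"
        using e_pos[of s] by (simp add: divide_le_eq algebra_simps)
      then show ?thesis
        using e_pos[of s] by (simp add: \<Phi>_def s_def)
    qed
    ultimately show ?thesis
      by (auto simp: bcontfun_def bounded_iff)
  qed
  define G where "G g = Bcontfun (\<Phi> (apply_bcontfun g))" for g
  have G: "apply_bcontfun (G g) = \<Phi> (apply_bcontfun g)" for g
    unfolding G_def by (rule Bcontfun_inverse) (rule \<Phi>, simp)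
  have "dist (G g) (G h) \<le> 1/2 * dist g h" for g h :: "real \<Rightarrow>\<^sub>C 'a"
  proof (rule dist_bound)
    fix t
    define s where "s = max t0 t"
    define d where "d = dist g h"
    have s: "s \<ge> t0" by (simp add: s_def)
    define \<Delta> where "\<Delta> t = F g t - F h t" for t
    \<comment> \<open>The weight has derivative \<open>2 * L * e\<close>, so the Lipschitz bound
      \<open>L * (e t * d)\<close> integrates to \<open>d / 2 * e t\<close>: the source of the
      contraction factor 1/2.\<close>
    define E where "E t = d / 2 * e t" for t
    have \<Delta>': "(\<Delta> has_vector_derivative f t (e t *\<^sub>R g t) - f t (e t *\<^sub>R h t)) (at t within {t0..})"
      if "t \<ge> t0" for t
      unfolding \<Delta>_def[abs_def] by (intro derivative_intros F' that) simp_all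
    have E': "(E has_vector_derivative L * (e t * d)) (at t within {t0..})" for t
      unfolding has_real_derivative_iff_has_vector_derivative[symmetric] E_def[abs_def] e_def
      by (auto intro!: derivative_eq_intros)
    have le: "norm (f t (e t *\<^sub>R g t) - f t (e t *\<^sub>R h t)) \<le> L * (e t * d)" if "t \<ge> t0" for t
    proof -
      have "norm (e t *\<^sub>R g t - e t *\<^sub>R h t) = e t * dist (g t) (h t)"
        using e_pos[of t] by (simp add: dist_norm flip: scaleR_diff_right)
      also have "\<dots> \<le> e t * d"
        using e_pos[of t] by (simp add: d_def dist_bounded)
      finally show ?thesis
        using lip[OF that, of "e t *\<^sub>R g t" "e t *\<^sub>R h t"] \<open>L > 0\<close>
        by (meson mult_left_mono less_imp_le order_trans)
    qed
    have "norm (\<Delta> s - \<Delta> t0) \<le> E s - E t0"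
      by (rule norm_diff_le_of_derivative_on_halfline[OF \<Delta>' E' le order_refl s])
    also have "\<dots> \<le> d / 2 * e s"
      using e_pos[of t0] by (simp add: E_def d_def)
    finally have "norm (F g s - F h s) / e s \<le> d / 2"
      using e_pos[of s] by (simp add: \<Delta>_def F_t0 divide_le_eq)
    then show "dist (G g t) (G h t) \<le> 1/2 * dist g h"
      using e_pos[of s]
      by (simp add: G \<Phi>_def dist_norm[where ?'a = 'a] flip: scaleR_diff_right s_def d_def)
  qed
  then obtain g where g: "G g = g"
    using banach_fix_type[of "1/2" G] by auto
  have fixpoint: "e t *\<^sub>R g t = F g t" if "t \<ge> t0" for t
  proof -
    have "g t = \<Phi> g t"
      by (metis G g)
    then show ?thesis
      using that e_pos[of t] by (simp add: \<Phi>_def max_absorb2)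
  qed
  show thesis
  proof (rule that)
    show "F g t0 = x0" by (rule F_t0)
    show "(F g has_vector_derivative f t (F g t)) (at t within {t0..})" if "t \<ge> t0" for t
      using F'[of g t] fixpoint[OF that] that by simp
  qed
qed

subsection \<open>Existence of trajectories\<close>

lemma inner_matrix_mult_left: "(A ** B) \<bullet> C = B \<bullet> (transpose A ** C)"
  for A :: "real^'n^'m" and B :: "real^'k^'n"
  by (simp add: inner_matrix_eq_trace matrix_transpose_mul matrix_mul_assoc)

lemma inner_matrix_mult_right: "(A ** B) \<bullet> C = A \<bullet> (C ** transpose B)"
  for A :: "real^'n^'m" and B :: "real^'k^'n"
  unfolding inner_matrix_eq_trace matrix_transpose_mul
  by (metis matrix_mul_assoc trace_mul_sym)

text \<open>Moving \<open>X\<close> to the other side of the inner product changes its sign, so each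
  expression equals its own negative. This conserves norms along the flow.\<close>

lemma inner_skew_mult:
  fixes A X :: "real^'n^'n"
  assumes "transpose X = - X"
  shows "A \<bullet> (A ** X) = 0" "A \<bullet> (X ** A) = 0"
proof -
  have "- A = -1 *\<^sub>R A" for A :: "real^'n^'n" by simp
  then have m: "A ** (- X) = - (A ** X)" "(- X) ** A = - (X ** A)"
    by (metis matrix_mult_scaleR(2) scaleR_minus1_left, metis matrix_mult_scaleR(1) scaleR_minus1_left)
  show "A \<bullet> (A ** X) = 0" "A \<bullet> (X ** A) = 0"
    using inner_matrix_mult_right[of A X A] inner_matrix_mult_left[of X A A]
    by (simp_all add: assms m inner_commute)
qed

text \<open>Projection onto a centred ball is radial: outside the ball, the reverse triangle
  inequality shows that \<open>(r / norm x) *\<^sub>R x\<close> is nearest.\<close>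

lemma closest_point_cball_0:
  fixes x :: "'a::euclidean_space"
  assumes "r \<ge> 0"
  shows "\<exists>c. closest_point (cball 0 r) x = c *\<^sub>R x"
proof (cases "norm x \<le> r")
  case True
  then show ?thesis
    by (intro exI[of _ 1]) (simp add: closest_point_self)
next
  case False
  then have x: "norm x > 0"
    using assms by linarith
  have "(r / norm x) *\<^sub>R x = closest_point (cball 0 r) x"
  proof (rule closest_point_unique)
    show "\<forall>z\<in>cball 0 r. dist x ((r / norm x) *\<^sub>R x) \<le> dist x z"
    proof
      fix z :: 'a assume "z \<in> cball 0 r"
      have "x - (r / norm x) *\<^sub>R x = (1 - r / norm x) *\<^sub>R x"
        by (simp add: scaleR_left_diff_distrib)
      then have "dist x ((r / norm x) *\<^sub>R x) = \<bar>1 - r / norm x\<bar> * norm x"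
        by (simp add: dist_norm)
      also have "\<dots> = norm x - r"
        using False x by (simp add: field_simps)
      also have "\<dots> \<le> dist x z"
        using norm_triangle_ineq2[of x z] \<open>z \<in> cball 0 r\<close> by (simp add: dist_norm)
      finally show "dist x ((r / norm x) *\<^sub>R x) \<le> dist x z" .
    qed
  qed (use assms x in auto)
  then show ?thesis by metis
qed

lemma bounded_bilinear_matrix_vector_mult:
  "bounded_bilinear ((*v) :: real^'n^'m \<Rightarrow> real^'n \<Rightarrow> real^'m)"
  by (rule bounded_bilinear.intro)
    (auto simp: matrix_vector_right_distrib matrix_vector_mult_add_rdistrib scaleR_matrix_vector_assoc
      matrix_vector_mult_scaleR intro!: exI[of _ 1] norm_matrix_vector_mult_le)

text \<open>The field is truncated outside the ball containing \<open>SO\<close>. This only rescales the argument,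
  so the truncated field is still \<open>Q\<close> times a skew matrix and keeps the norm of \<open>Q\<close> constant.\<close>
lemma trajectory_exists:
  fixes y :: "real \<Rightarrow> real^'n"
  assumes y: "continuous_on {t0..} y" "\<And>t. t \<ge> t0 \<Longrightarrow> norm (y t) = 1"
    and Q0: "Q0 \<in> SO"
  obtains Q where "trajectory y t0 Q" "Q t0 = Q0"
proof -
  define r where "r = norm Q0"
  define \<phi> where "\<phi> = closest_point (cball (0::real^'n^'n) r)"
  define X where "X t P = outer (transpose P *v y t) (y t) - outer (y t) (transpose P *v y t)" for t P
  have skew: "transpose (X t P) = - X t P" for t P
    by (simp add: X_def transpose_diff transpose_outer)
  have X_diff: "X t P - X t R = X t (P - R)" for t P R
    by (simp add: X_def transpose_diff matrix_vector_mult_diff_rdistrib outer_linear algebra_simps)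
  have X_le: "norm (X t P) \<le> 2 * norm P" if "t \<ge> t0" for t P
  proof -
    have "norm (X t P) \<le> norm (transpose P *v y t) * 1 + 1 * norm (transpose P *v y t)"
      unfolding X_def by (rule order_trans[OF norm_triangle_ineq4]) (simp add: norm_outer y that)
    also have "norm (transpose P *v y t) \<le> norm P"
      using norm_matrix_vector_mult_le[of "transpose P" "y t"] by (simp add: norm_transpose y that)
    finally show ?thesis by simp
  qed
  have r: "r \<ge> 0"
    by (simp add: r_def)
  have \<phi>_le: "norm (\<phi> P) \<le> r" for P
    using closest_point_in_set[of "cball 0 r" P] r by (simp add: \<phi>_def)
  have \<phi>_lip: "norm (\<phi> P - \<phi> R) \<le> norm (P - R)" for P R
    using closest_point_lipschitz[of "cball 0 r" P R] r by (simp add: \<phi>_def dist_norm)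
  have \<phi>_cont: "continuous_on UNIV \<phi>"
    unfolding \<phi>_def by (rule continuous_on_closest_point) (use r in auto)
  define f where "f t P = \<phi> P ** X t (\<phi> P)" for t P
  obtain Q where Q: "Q t0 = Q0"
    and Q': "\<And>t. t \<ge> t0 \<Longrightarrow> (Q has_vector_derivative f t (Q t)) (at t within {t0..})"
  \<comment> \<open>The field is bilinear in the truncated matrix, whose norm is at most
    \<open>r\<close>; this gives the Lipschitz constant \<open>4 * r\<close>. Adding 1 makes it
    positive.\<close>
  proof (rule global_solution_exists[of t0 f "4 * r + 1" "2 * r * r" Q0])
    fix g :: "real \<Rightarrow> real^'n^'n" assume g: "continuous_on {t0..} g"
    have "continuous_on {t0..} (\<lambda>t. \<phi> (g t))"
      by (rule continuous_on_compose2[OF \<phi>_cont g]) simp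
    moreover have "continuous_on {t0..} (\<lambda>t. transpose (\<phi> (g t)) *v y t)"
      by (intro bounded_bilinear.continuous_on[OF bounded_bilinear_matrix_vector_mult]
          bounded_linear.continuous_on[OF bounded_linear_transpose] calculation y(1))
    ultimately show "continuous_on {t0..} (\<lambda>t. f t (g t))"
      unfolding f_def X_def
      by (intro bounded_bilinear.continuous_on[OF bounded_bilinear_matrix_mult]
          bounded_bilinear.continuous_on[OF bounded_bilinear_outer] continuous_on_diff y(1))
  next
    fix t :: real and P R :: "real^'n^'n" assume t: "t \<ge> t0"
    have "f t P - f t R = \<phi> P ** X t (\<phi> P - \<phi> R) + (\<phi> P - \<phi> R) ** X t (\<phi> R)"
      unfolding f_def X_diff[symmetric] by (simp add: matrix_diff_distrib)
    also have "norm \<dots> \<le> norm (\<phi> P) * norm (X t (\<phi> P - \<phi> R)) + norm (\<phi> P - \<phi> R) * norm (X t (\<phi> R))"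
      by (intro norm_triangle_le add_mono norm_matrix_mult_le)
    also have "\<dots> \<le> r * (2 * norm (\<phi> P - \<phi> R)) + norm (\<phi> P - \<phi> R) * (2 * r)"
      using \<phi>_le X_le[OF t] r by (intro add_mono mult_mono) (auto intro: order_trans[OF X_le[OF t]])
    also have "\<dots> = (4 * r) * norm (\<phi> P - \<phi> R)"
      by simp
    also have "\<dots> \<le> (4 * r + 1) * norm (P - R)"
      using \<phi>_lip r by (intro mult_mono) auto
    finally show "norm (f t P - f t R) \<le> (4 * r + 1) * norm (P - R)" .
  next
    fix t :: real and P :: "real^'n^'n" assume t: "t \<ge> t0"
    have "norm (f t P) \<le> norm (\<phi> P) * norm (X t (\<phi> P))"
      unfolding f_def by (rule norm_matrix_mult_le)
    also have "\<dots> \<le> r * (2 * r)"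
      using \<phi>_le r by (intro mult_mono order_trans[OF X_le[OF t]]) auto
    finally show "norm (f t P) \<le> 2 * r * r"
      by simp
  qed (use r in auto)
  have norm_Q: "norm (Q t) = r" if "t \<ge> t0" for t
  proof -
    have "((\<lambda>t. Q t \<bullet> Q t) has_vector_derivative 0) (at t within {t0..})" if t: "t \<ge> t0" for t
    proof -
      obtain c where "\<phi> (Q t) = c *\<^sub>R Q t"
        using closest_point_cball_0[OF r] unfolding \<phi>_def by blast
      then have "Q t \<bullet> f t (Q t) = 0"
        by (simp add: f_def matrix_mult_scaleR inner_skew_mult skew)
      then show ?thesis
        using bounded_bilinear.has_vector_derivative[OF bounded_bilinear_inner Q'[OF t] Q'[OF t]]
        by (simp add: inner_commute)
    qed
    from constant_of_derivative_on_halfline[OF this that] show ?thesis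
      by (simp add: r_def Q norm_eq_sqrt_inner)
  qed
  \<comment> \<open>The norm stays equal to \<open>r\<close>, so the truncation is never
    active.\<close>
  have Q'': "(Q has_vector_derivative Q t ** X t (Q t)) (at t within {t0..})" if "t \<ge> t0" for t
    using Q'[OF that] norm_Q[OF that] by (simp add: f_def \<phi>_def closest_point_self)
  \<comment> \<open>\<open>R\<close> is the defect from orthogonality. Its derivative is the
    commutator of \<open>R\<close> with a skew matrix, which is orthogonal to \<open>R\<close>, so
    \<open>R\<close> remains 0.\<close>
  define R where "R t = transpose (Q t) ** Q t - mat 1" for t
  have R: "R t = 0" if "t \<ge> t0" for t
  proof -
    have "((\<lambda>t. R t \<bullet> R t) has_vector_derivative 0) (at t within {t0..})" if t: "t \<ge> t0" for t
    proof -
      let ?X = "X t (Q t)"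
      have "(R has_vector_derivative (transpose (Q t) ** (Q t ** ?X) + transpose (Q t ** ?X) ** Q t) - 0)
          (at t within {t0..})"
        unfolding R_def
        by (intro derivative_intros bounded_bilinear.has_vector_derivative[OF bounded_bilinear_matrix_mult]
            bounded_linear.has_vector_derivative[OF bounded_linear_transpose] Q'' t)
      also have "(transpose (Q t) ** (Q t ** ?X) + transpose (Q t ** ?X) ** Q t) - 0 = R t ** ?X - ?X ** R t"
        by (simp add: R_def matrix_transpose_mul skew matrix_mul_assoc matrix_diff_distrib
            bounded_bilinear.minus_left[OF bounded_bilinear_matrix_mult])
      finally have R': "(R has_vector_derivative R t ** ?X - ?X ** R t) (at t within {t0..})" .
      have "R t \<bullet> (R t ** ?X - ?X ** R t) = 0"
        by (simp add: inner_diff_right inner_skew_mult skew)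
      then show ?thesis
        using bounded_bilinear.has_vector_derivative[OF bounded_bilinear_inner R' R']
        by (simp add: inner_commute)
    qed
    from constant_of_derivative_on_halfline[OF this that] show ?thesis
      by (simp add: R_def Q SO_inverse[OF Q0])
  qed
  have "Q t \<in> SO" if "t \<ge> t0" for t
  proof (rule orthogonal_path_in_SO)
    show "continuous_on {t0..t} Q"
      by (rule continuous_on_subset[of "{t0..}"])
        (auto simp: continuous_on_eq_continuous_within intro: has_vector_derivative_continuous Q'')
    show "transpose (Q s) ** Q s = mat 1" if "s \<in> {t0..t}" for s
      using R[of s] that by (simp add: R_def)
    show "det (Q t0) = 1"
      using Q0 by (simp add: Q SO_iff)
  qed fact
  then have "trajectory y t0 Q"
    using Q'' unfolding trajectory_def field_eq X_def by simp
  then show thesis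
    using Q by (rule that)
qed

subsection \<open>Symmetric rotations are not local maxima of the trace\<close>

text \<open>Conjugation by an orthogonal matrix taking a basis vector to \<open>a\<close> reduces to
  a diagonal matrix with a single entry -1.\<close>

lemma det_reflection:
  fixes a :: "real^'n"
  assumes "norm a = 1"
  shows "det (mat 1 - 2 *\<^sub>R outer a a) = -1"
proof -
  fix k :: 'n
  obtain A where A: "orthogonal_matrix A" "A *v axis k 1 = a"
    using orthogonal_matrix_exists_basis[OF assms] by metis
  define S :: "real^'n^'n" where "S = mat 1 - 2 *\<^sub>R outer (axis k 1) (axis k 1)"
  have "A ** S ** transpose A = mat 1 - 2 *\<^sub>R outer a a"
    using A by (simp add: S_def matrix_diff_distrib matrix_mult_scaleR matrix_mult_outer outer_matrix_mult
        transpose_transpose orthogonal_matrix_def)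
  moreover have "det (A ** S ** transpose A) = det S"
    using det_orthogonal_matrix[OF A(1)] by (auto simp: det_mul det_transpose)
  moreover have "det S = (\<Prod>i\<in>UNIV. S$i$i)"
    by (rule det_diagonal) (auto simp: S_def mat_def outer_def axis_def)
  moreover have "S$i$i = (if i = k then -1 else 1)" for i
    by (simp add: S_def mat_def outer_def axis_def)
  ultimately show ?thesis
    by (simp add: prod.delta)
qed

text \<open>An involution reverses \<open>v - S *v v\<close>, which is nonzero for any
  \<open>v\<close> that it moves.\<close>

lemma involution_eigenvector:
  fixes S :: "real^'n^'n"
  assumes "S ** S = mat 1" "S \<noteq> mat 1"
  obtains a where "norm a = 1" "S *v a = - a"
proof -
  obtain v where v: "S *v v \<noteq> v"
    using assms(2) by (metis matrix_eq matrix_vector_mul_lid)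
  define w where "w = v - S *v v"
  have "S *v w = - w"
    by (simp add: w_def matrix_vector_mult_diff_distrib matrix_vector_mul_assoc assms(1))
  then have "S *v sgn w = - sgn w"
    by (simp add: sgn_div_norm matrix_vector_mult_scaleR)
  moreover have "norm (sgn w) = 1"
    using v by (simp add: norm_sgn w_def)
  ultimately show thesis
    by (rule that[rotated])
qed

text \<open>If the \<open>-1\<close> eigenspace of \<open>P\<close> were spanned by \<open>a\<close>, then \<open>P\<close> would be
  a reflection and have determinant \<open>-1\<close>.\<close>
lemma symmetric_rotation_eigenvectors:
  fixes P :: "real^'n^'n"
  assumes "P \<in> SO" "transpose P = P" "P \<noteq> mat 1"
  obtains a b where "norm a = 1" "norm b = 1" "a \<bullet> b = 0" "P *v a = - a" "P *v b = - b"
proof -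
  have PP: "P ** P = mat 1"
    using SO_inverse(1)[OF assms(1)] assms(2) by simp
  obtain a where a: "norm a = 1" "P *v a = - a"
    using involution_eigenvector[OF PP assms(3)] .
  have aa: "a \<bullet> a = 1"
    using a(1) by (simp add: norm_eq_1)
  \<comment> \<open>\<open>S\<close> is \<open>P\<close> composed with the reflection along
    \<open>a\<close>: a symmetric involution fixing \<open>a\<close>, with determinant -1 and so not
    the identity. Its own -1 eigenvector is orthogonal to \<open>a\<close>, hence also negated by
    \<open>P\<close>.\<close>
  define S where "S = P + 2 *\<^sub>R outer a a"
  have S: "P ** (mat 1 - 2 *\<^sub>R outer a a) = S"
    by (simp add: S_def matrix_diff_distrib matrix_mult_scaleR matrix_mult_outer a outer_linear)
  have Sa: "S *v a = a"
  proof -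
    have "S *v a = P *v a + 2 *\<^sub>R (outer a a *v a)"
      by (simp add: S_def matrix_vector_mult_add_rdistrib flip: scaleR_matrix_vector_assoc)
    also have "\<dots> = (2 - 1) *\<^sub>R a"
      unfolding scaleR_left_diff_distrib by (simp add: a outer_vec aa)
    finally show ?thesis by simp
  qed
  from S have "det S = -1"
    using det_mul[of P "mat 1 - 2 *\<^sub>R outer a a"] assms(1) by (simp add: det_reflection[OF a(1)] SO_iff)
  then have "S \<noteq> mat 1"
    by auto
  moreover have "S ** S = mat 1"
  proof -
    have "S ** S = S ** P + 2 *\<^sub>R outer a a"
      by (subst (2) S_def) (simp add: matrix_add_ldistrib matrix_mult_scaleR matrix_mult_outer Sa)
    also have "S ** P = mat 1 - 2 *\<^sub>R outer a a"
      by (simp add: S_def matrix_add_rdistrib matrix_mult_scaleR outer_matrix_mult PP assms(2) a outer_linear)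
    finally show ?thesis by simp
  qed
  ultimately obtain b where b: "norm b = 1" "S *v b = - b"
    using involution_eigenvector by metis
  have "transpose S = S"
    by (simp add: S_def transpose_add transpose_scaleR transpose_outer assms(2))
  then have "a \<bullet> b = - (a \<bullet> b)"
    using inner_transpose_mult[of S a b] by (simp add: Sa b)
  then have ab: "a \<bullet> b = 0"
    by simp
  have "P *v b = - b"
    using b(2) by (simp add: S_def matrix_vector_mult_add_rdistrib outer_vec ab flip: scaleR_matrix_vector_assoc)
  then show thesis
    using that[of a b] a b(1) ab by simp
qed

text \<open>For orthonormal \<open>a\<close> and \<open>b\<close>, the rotation through \<theta> in
  their plane that fixes the orthogonal complement; \<open>S_0 y\<close> uses the same formula with
  \<open>a = y\<close>.\<close>

definition plane_rotation :: "real^'n \<Rightarrow> real^'n \<Rightarrow> real \<Rightarrow> real^'n^'n" where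
  "plane_rotation a b \<theta> = mat 1 + (cos \<theta> - 1) *\<^sub>R (outer a a + outer b b) + sin \<theta> *\<^sub>R (outer a b - outer b a)"

lemma continuous_on_plane_rotation: "continuous_on S (plane_rotation a b)"
  unfolding plane_rotation_def[abs_def] by (intro continuous_intros)

lemma plane_rotation_0: "plane_rotation a b 0 = mat 1"
  by (simp add: plane_rotation_def)

text \<open>\<open>E\<close> projects onto the plane and \<open>J\<close> is a quarter turn in it,
  so orthogonality reduces to the Pythagorean identity. Determinant 1 is carried along the path from
  angle 0.\<close>

lemma plane_rotation_in_SO:
  assumes "norm a = 1" "norm b = 1" "a \<bullet> b = 0" "\<theta> \<ge> 0"
  shows "plane_rotation a b \<theta> \<in> SO"
proof (rule orthogonal_path_in_SO[of 0])
  fix t :: real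
  define E where "E = outer a a + outer b b"
  define J where "J = outer a b - outer b a"
  have ab: "a \<bullet> a = 1" "b \<bullet> b = 1" "a \<bullet> b = 0" "b \<bullet> a = 0"
    using assms by (simp_all add: norm_eq_1 inner_commute)
  have prods: "E ** E = E" "E ** J = J" "J ** E = J" "J ** J = - E"
    by (simp_all add: E_def J_def matrix_add_ldistrib matrix_add_rdistrib matrix_diff_distrib
        matrix_mult_outer outer_vec ab outer_linear matrix_vector_mult_add_rdistrib
        matrix_vector_mult_diff_rdistrib)
  have "transpose E = E" "transpose J = - J"
    by (simp_all add: E_def J_def transpose_add transpose_diff transpose_outer)
  then have "transpose (plane_rotation a b t) ** plane_rotation a b t
      = (mat 1 + (cos t - 1) *\<^sub>R E - sin t *\<^sub>R J) ** (mat 1 + (cos t - 1) *\<^sub>R E + sin t *\<^sub>R J)"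
    by (simp add: plane_rotation_def transpose_add transpose_scaleR transpose_mat flip: E_def J_def)
  also have "\<dots> = mat 1 - E + ((cos t)\<^sup>2 *\<^sub>R E + (sin t)\<^sup>2 *\<^sub>R E)"
    by (simp add: matrix_add_ldistrib matrix_add_rdistrib matrix_diff_distrib matrix_mult_scaleR prods)
      (simp add: algebra_simps power2_eq_square)
  also have "\<dots> = mat 1"
    by (simp flip: scaleR_add_left)
  finally show "transpose (plane_rotation a b t) ** plane_rotation a b t = mat 1"
    by simp
qed (use assms(4) in \<open>simp_all add: continuous_on_plane_rotation plane_rotation_0\<close>)

lemma bounded_linear_trace: "bounded_linear (trace :: real^'n^'n \<Rightarrow> real)"
  unfolding trace_eq_inner_mat_1[abs_def] by (rule bounded_linear_inner_left)

lemmas trace_linear =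
  bounded_linear_trace[THEN bounded_linear.linear, THEN linear_add]
  bounded_linear_trace[THEN bounded_linear.linear, THEN linear_diff]
  bounded_linear_trace[THEN bounded_linear.linear, THEN linear_scale]
  bounded_linear_trace[THEN bounded_linear.linear, THEN linear_neg]

text \<open>Composing \<open>P\<close> with a rotation of a plane on which \<open>P\<close> is -1
  raises the trace by \<open>2 * (1 - cos \<theta>)\<close>.\<close>

lemma symmetric_rotation_increase_trace:
  fixes P :: "real^'n^'n"
  assumes "P \<in> SO" "transpose P = P" "P \<noteq> mat 1" "\<epsilon> > 0"
  obtains R where "R \<in> SO" "dist R P < \<epsilon>" "trace R > trace P"
proof -
  obtain a b where ab: "norm a = 1" "norm b = 1" "a \<bullet> b = 0" and P: "P *v a = - a" "P *v b = - b"
    using symmetric_rotation_eigenvectors[OF assms(1-3)] .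
  define R where "R \<theta> = P ** plane_rotation a b \<theta>" for \<theta>
  have "continuous_on UNIV R"
    unfolding R_def[abs_def]
    by (intro bounded_bilinear.continuous_on[OF bounded_bilinear_matrix_mult] continuous_on_plane_rotation
        continuous_intros)
  then obtain d where d: "d > 0" "\<And>\<theta>. \<bar>\<theta>\<bar> < d \<Longrightarrow> dist (R \<theta>) (R 0) < \<epsilon>"
    using assms(4) unfolding continuous_on_iff by (metis UNIV_I dist_norm diff_zero real_norm_def)
  define \<theta> where "\<theta> = min (d / 2) 1"
  have \<theta>: "0 < \<theta>" "\<bar>\<theta>\<bar> < d" "\<theta> \<le> 1"
    using d(1) by (auto simp: \<theta>_def)
  have "R \<theta> \<in> SO"
    unfolding R_def using ab \<theta>(1) by (intro SO_matrix_mult assms(1) plane_rotation_in_SO) auto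
  moreover have "dist (R \<theta>) P < \<epsilon>"
    using d(2)[OF \<theta>(2)] by (simp add: R_def plane_rotation_0)
  moreover have "trace (R \<theta>) = trace P + 2 * (1 - cos \<theta>)"
    using ab by (simp add: R_def plane_rotation_def matrix_add_ldistrib matrix_diff_distrib matrix_mult_scaleR
        matrix_mult_outer P trace_linear trace_outer inner_commute[of b a] norm_eq_1)
  moreover have "cos \<theta> < 1"
    using cos_monotone_0_pi[of 0 \<theta>] \<theta> pi_gt3 by simp
  ultimately show thesis
    using that[of "R \<theta>"] by simp
qed

subsection \<open>Persistently exciting reference direction\<close>

lemma norm_power2_matrix_vector_mult:
  fixes W :: "real^'n^'m"
  shows "(norm (W *v v))\<^sup>2 = (\<Sum>i\<in>UNIV. (W$i \<bullet> v)\<^sup>2)"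
  unfolding power2_norm_eq_inner inner_vec_def[of "W *v v"]
  by (simp add: matrix_mult_dot power2_eq_square)

lemma norm_power2_matrix:
  fixes W :: "real^'n^'m"
  shows "(norm W)\<^sup>2 = (\<Sum>i\<in>UNIV. (norm (W$i))\<^sup>2)"
  by (simp add: norm_vec_def[of W] L2_set_def sum_nonneg)

section \<open>Persistent excitation as a lower bound on window integrals\<close>

locale excited_reference =
  fixes y :: "real \<Rightarrow> real^'n" and T \<alpha> :: real
  assumes norm_y: "\<And>t. t \<ge> 0 \<Longrightarrow> norm (y t) = 1"
    and continuous_y: "continuous_on {0..} y"
    and T: "T > 0" and \<alpha>: "\<alpha> > 0"
    and excited: "\<And>t. t > 0 \<Longrightarrow>
      positive_definite ((1/T) *\<^sub>R integral {t..t+T} (\<lambda>s. M12 (y s)) - \<alpha> *\<^sub>R mat 1)"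
begin

text \<open>The quadratic form of the integrated matrix at \<open>x\<close> is the integral of the
  squared inner products, which positive definiteness bounds from below.\<close>

lemma excited_vector:
  assumes t: "t > 0"
  shows "(\<lambda>s. (x \<bullet> y s)\<^sup>2) integrable_on {t..t+T}"
    and "\<alpha> * T * (norm x)\<^sup>2 \<le> integral {t..t+T} (\<lambda>s. (x \<bullet> y s)\<^sup>2)"
proof -
  have y: "continuous_on {t..t+T} y"
    using continuous_y by (rule continuous_on_subset) (use t in auto)
  show int: "(\<lambda>s. (x \<bullet> y s)\<^sup>2) integrable_on {t..t+T}"
    by (intro integrable_continuous_real continuous_intros y)
  define M where "M = integral {t..t+T} (\<lambda>s. M12 (y s))"
  have M: "(\<lambda>s. M12 (y s)) integrable_on {t..t+T}"
    unfolding M12_def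
    by (intro integrable_continuous_real bounded_bilinear.continuous_on[OF bounded_bilinear_outer] y)
  have "bounded_linear (\<lambda>A. x \<bullet> (A *v x))"
    using bounded_linear_compose[OF bounded_linear_inner_right bounded_linear_matrix_vector_mult_left] .
  from integral_linear[OF M this]
  have xMx: "x \<bullet> (M *v x) = integral {t..t+T} (\<lambda>s. (x \<bullet> y s)\<^sup>2)"
    by (simp add: o_def M12_def outer_vec M_def power2_eq_square inner_commute)
  show "\<alpha> * T * (norm x)\<^sup>2 \<le> integral {t..t+T} (\<lambda>s. (x \<bullet> y s)\<^sup>2)"
  proof (cases "x = 0")
    case False
    then have "0 < x \<bullet> (((1/T) *\<^sub>R M - \<alpha> *\<^sub>R mat 1) *v x)"
      using excited[OF t] by (simp add: positive_definite_def M_def)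
    also have "\<dots> = (1/T) * (x \<bullet> (M *v x)) - \<alpha> * (norm x)\<^sup>2"
      by (simp add: matrix_vector_mult_diff_rdistrib inner_diff_right power2_norm_eq_inner
          flip: scaleR_matrix_vector_assoc)
    finally have "T * (\<alpha> * (norm x)\<^sup>2) \<le> T * ((1/T) * (x \<bullet> (M *v x)))"
      using T by (intro mult_left_mono) auto
    then show ?thesis
      using T by (simp add: xMx mult_ac)
  qed simp
qed

text \<open>The vector bound summed over the rows of \<open>W\<close>.\<close>

lemma excited_matrix:
  assumes t: "t > 0"
  shows "(\<lambda>s. (norm (W *v y s))\<^sup>2) integrable_on {t..t+T}"
    and "\<alpha> * T * (norm W)\<^sup>2 \<le> integral {t..t+T} (\<lambda>s. (norm (W *v y s))\<^sup>2)"
proof -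
  show "(\<lambda>s. (norm (W *v y s))\<^sup>2) integrable_on {t..t+T}"
    unfolding norm_power2_matrix_vector_mult by (intro integrable_sum excited_vector t) simp
  have "\<alpha> * T * (norm W)\<^sup>2 \<le> (\<Sum>i\<in>UNIV. integral {t..t+T} (\<lambda>s. (W$i \<bullet> y s)\<^sup>2))"
    unfolding norm_power2_matrix sum_distrib_left by (intro sum_mono excited_vector t)
  also have "\<dots> = integral {t..t+T} (\<lambda>s. (norm (W *v y s))\<^sup>2)"
    unfolding norm_power2_matrix_vector_mult
    by (rule integral_sum[symmetric]) (auto intro: excited_vector t)
  finally show "\<alpha> * T * (norm W)\<^sup>2 \<le> integral {t..t+T} (\<lambda>s. (norm (W *v y s))\<^sup>2)" .
qed

end

section \<open>Trace and skew part along a trajectory\<close>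

locale excited_trajectory = excited_reference +
  fixes t0 :: real and Q :: "real \<Rightarrow> real^'n^'n"
  assumes t0: "t0 \<ge> 0" and traj: "trajectory y t0 Q"
begin

definition W where "W t = Q t - transpose (Q t)"

lemma in_SO: "t \<ge> t0 \<Longrightarrow> Q t \<in> SO"
  using trajectory_in_SO[OF traj] .

lemma norm_y': "t \<ge> t0 \<Longrightarrow> norm (y t) = 1"
  using norm_y t0 by simp

text \<open>The trace of the field is 1 minus the inner product of the unit vectors
  \<open>Q y\<close> and \<open>Q\<^sup>T y\<close>, that is, half their squared distance.\<close>

lemma trace_derivative:
  assumes "t \<ge> t0"
  shows "((\<lambda>t. trace (Q t)) has_vector_derivative (norm (W t *v y t))\<^sup>2 / 2) (at t within {t0..})"
proof -
  have "(norm (W t *v y t))\<^sup>2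
      = (norm (Q t *v y t))\<^sup>2 + (norm (transpose (Q t) *v y t))\<^sup>2
        - 2 * ((Q t *v y t) \<bullet> (transpose (Q t) *v y t))"
    unfolding W_def power2_norm_eq_inner
    by (simp add: matrix_vector_mult_diff_rdistrib inner_diff inner_commute)
  then have "(norm (W t *v y t))\<^sup>2 / 2 = trace (outer (y t) (y t) - outer (Q t *v y t) (transpose (Q t) *v y t))"
    using norm_y'[OF assms]
    by (simp add: norm_SO norm_transpose_SO in_SO[OF assms] trace_linear trace_outer norm_eq_1)
  then show ?thesis
    using bounded_linear.has_vector_derivative[OF bounded_linear_trace trajectory_derivative[OF traj assms]]
    by simp
qed

lemma trace_mono: "t0 \<le> s \<Longrightarrow> s \<le> t \<Longrightarrow> trace (Q s) \<le> trace (Q t)"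
  by (rule mono_of_derivative_on_halfline[OF trace_derivative]) auto

text \<open>Antisymmetrising the field cancels the symmetric term \<open>outer (y t) (y t)\<close>;
  subtracting \<open>outer v v\<close> from both remaining terms exhibits the factor
  \<open>u - v = W t *v y t\<close>.\<close>

lemma W_derivative:
  assumes "t \<ge> t0"
  obtains W' where "(W has_vector_derivative W') (at t within {t0..})" "norm W' \<le> 2 * norm (W t *v y t)"
proof -
  define u v where "u = Q t *v y t" and "v = transpose (Q t) *v y t"
  have v: "norm v = 1" and w: "W t *v y t = u - v"
    using norm_y'[OF assms] by (simp_all add: v_def u_def W_def norm_transpose_SO in_SO[OF assms]
        matrix_vector_mult_diff_rdistrib)
  have "(W has_vector_derivative (outer (y t) (y t) - outer u v) - transpose (outer (y t) (y t) - outer u v))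
      (at t within {t0..})"
    unfolding W_def[abs_def] u_def v_def
    by (intro derivative_intros bounded_linear.has_vector_derivative[OF bounded_linear_transpose]
        trajectory_derivative[OF traj assms])
  moreover have "(outer (y t) (y t) - outer u v) - transpose (outer (y t) (y t) - outer u v)
      = outer v (u - v) - outer (u - v) v"
    by (simp add: transpose_diff transpose_outer outer_linear)
  moreover have "norm (outer v (u - v) - outer (u - v) v) \<le> 2 * norm (u - v)"
    by (rule order_trans[OF norm_triangle_ineq4]) (simp add: norm_outer v)
  ultimately show thesis
    using that by (simp add: w)
qed

text \<open>Young's inequality bounds the speed of \<open>W\<close> by the speed of the trace.\<close>
lemma norm_W_diff_le:
  assumes "\<kappa> > 0" "t0 \<le> s" "s \<le> t"
  shows "norm (W t - W s) \<le> \<kappa> * (t - s) + 2 / \<kappa> * (trace (Q t) - trace (Q s))"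
proof -
  \<comment> \<open>Choice turns the pointwise derivatives into one function, to which the mean
    value inequality applies.\<close>
  define W' where "W' t = (SOME D. (W has_vector_derivative D) (at t within {t0..})
    \<and> norm D \<le> 2 * norm (W t *v y t))" for t
  have W': "(W has_vector_derivative W' t) (at t within {t0..}) \<and> norm (W' t) \<le> 2 * norm (W t *v y t)"
    if "t \<ge> t0" for t
    unfolding W'_def by (rule someI_ex) (meson W_derivative that)
  define g where "g t = \<kappa> * t + 2 / \<kappa> * trace (Q t)" for t
  have g': "(g has_vector_derivative \<kappa> + (norm (W t *v y t))\<^sup>2 / \<kappa>) (at t within {t0..})" if "t \<ge> t0" for t
  proof -
    note trace_derivative[OF that, folded has_real_derivative_iff_has_vector_derivative]
    then show ?thesis
      unfolding g_def[abs_def] has_real_derivative_iff_has_vector_derivative[symmetric]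
      using assms(1) by (auto intro!: derivative_eq_intros)
  qed
  have le: "norm (W' t) \<le> \<kappa> + (norm (W t *v y t))\<^sup>2 / \<kappa>" if "t \<ge> t0" for t
  proof -
    have "2 * a \<le> \<kappa> + a\<^sup>2 / \<kappa>" for a :: real
      using sum_squares_bound[of a \<kappa>] assms(1) by (simp add: field_simps power2_eq_square)
    then show ?thesis
      using W'[OF that] order_trans by blast
  qed
  have "norm (W t - W s) \<le> g t - g s"
    by (rule norm_diff_le_of_derivative_on_halfline[OF conjunct1[OF W'] g' le assms(2,3)])
  then show ?thesis
    by (simp add: g_def algebra_simps)
qed

lemma trace_le: "t \<ge> t0 \<Longrightarrow> trace (Q t) \<le> CARD('n)"
  using norm_diff_mat_1_SO[OF in_SO] by (smt (verit) zero_le_power2)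

lemma trace_converges: obtains l where "((\<lambda>t. trace (Q t)) \<longlongrightarrow> l) at_top"
proof -
  define \<tau> where "\<tau> t = trace (Q t)" for t
  have bdd: "bdd_above (\<tau> ` {t0..})"
    using trace_le by (auto simp: \<tau>_def bdd_above_def)
  have "(\<tau> \<longlongrightarrow> (SUP t\<in>{t0..}. \<tau> t)) at_top"
  proof (rule increasing_tendsto)
    show "\<forall>\<^sub>F t in at_top. \<tau> t \<le> (SUP t\<in>{t0..}. \<tau> t)"
      using eventually_ge_at_top[of t0] by eventually_elim (auto intro: cSUP_upper bdd)
  next
    fix x assume "x < (SUP t\<in>{t0..}. \<tau> t)"
    then obtain s where s: "s \<ge> t0" "x < \<tau> s"
      using less_cSUP_iff[OF _ bdd, of x] by auto
    show "\<forall>\<^sub>F t in at_top. x < \<tau> t"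
      using eventually_ge_at_top[of s]
      by eventually_elim (use s trace_mono in \<open>force simp: \<tau>_def\<close>)
  qed
  then show thesis
    unfolding \<tau>_def by (rule that)
qed

lemma norm_W_window_le:
  assumes "\<kappa> > 0" "t \<ge> t0" "t > 0" "trace (Q (t + T)) - trace (Q t) \<le> \<kappa>\<^sup>2"
  shows "\<alpha> * T * (norm (W t))\<^sup>2 \<le> \<kappa>\<^sup>2 * (4 + 2 * T * (T + 2)\<^sup>2)"
proof -
  define g where "g s = (norm (W s *v y s))\<^sup>2" for s
  have "((\<lambda>s. g s / 2) has_integral (trace (Q (t + T)) - trace (Q t))) {t..t+T}"
    using has_integral_of_derivative_on_halfline[OF trace_derivative] assms T by (simp add: g_def)
  \<comment> \<open>The factor 4 turns \<open>g / 2\<close> into the \<open>2 * g\<close> of the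
    inequality \<open>(a + b)^2 \<le> 2 a^2 + 2 b^2\<close>.\<close>
  from has_integral_mult_right[OF this, of 4]
  have "((\<lambda>s. 2 * g s) has_integral 4 * (trace (Q (t + T)) - trace (Q t))) {t..t+T}"
    by simp
  moreover have "((\<lambda>s. 2 * (\<kappa> * (T + 2))\<^sup>2) has_integral T * (2 * (\<kappa> * (T + 2))\<^sup>2)) {t..t+T}"
    using has_integral_const_real[of "2 * (\<kappa> * (T + 2))\<^sup>2" t "t + T"] T by simp
  ultimately have int: "((\<lambda>s. 2 * g s + 2 * (\<kappa> * (T + 2))\<^sup>2) has_integral
      4 * (trace (Q (t + T)) - trace (Q t)) + T * (2 * (\<kappa> * (T + 2))\<^sup>2)) {t..t+T}"
    by (rule has_integral_add)
  have "(norm (W t *v y s))\<^sup>2 \<le> 2 * g s + 2 * (\<kappa> * (T + 2))\<^sup>2" if s: "s \<in> {t..t+T}" for s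
  proof -
    have s': "s \<ge> t0" "t \<le> s" "s \<le> t + T"
      using s assms(2) by auto
    have "norm (W t *v y s - W s *v y s) \<le> norm (W t - W s) * norm (y s)"
      using norm_matrix_vector_mult_le[of "W t - W s" "y s"] by (simp add: matrix_vector_mult_diff_rdistrib)
    also have "\<dots> = norm (W s - W t)"
      using norm_y'[OF s'(1)] by (simp add: norm_minus_commute)
    also have "\<dots> \<le> \<kappa> * (s - t) + 2 / \<kappa> * (trace (Q s) - trace (Q t))"
      by (rule norm_W_diff_le[OF assms(1,2) s'(2)])
    also have "\<dots> \<le> \<kappa> * T + 2 / \<kappa> * \<kappa>\<^sup>2"
      using s' assms trace_mono[OF s'(1,3)] by (intro add_mono mult_left_mono) auto
    also have "\<dots> = \<kappa> * (T + 2)"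
      using assms(1) by (simp add: power2_eq_square algebra_simps)
    finally have "norm (W t *v y s) \<le> norm (W s *v y s) + \<kappa> * (T + 2)"
      using norm_triangle_sub[of "W t *v y s" "W s *v y s"] by linarith
    then have "(norm (W t *v y s))\<^sup>2 \<le> (norm (W s *v y s) + \<kappa> * (T + 2))\<^sup>2"
      by (intro power_mono) auto
    also have "\<dots> \<le> 2 * g s + 2 * (\<kappa> * (T + 2))\<^sup>2"
      using sum_squares_bound[of "norm (W s *v y s)" "\<kappa> * (T + 2)"]
      unfolding g_def power2_sum by linarith
    finally show ?thesis .
  qed
  then have "integral {t..t+T} (\<lambda>s. (norm (W t *v y s))\<^sup>2)
      \<le> 4 * (trace (Q (t + T)) - trace (Q t)) + T * (2 * (\<kappa> * (T + 2))\<^sup>2)"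
    by (intro has_integral_le[OF integrable_integral[OF excited_matrix(1)[OF assms(3)]] int])
  also have "\<dots> \<le> 4 * \<kappa>\<^sup>2 + T * (2 * (\<kappa> * (T + 2))\<^sup>2)"
    using assms(4) by simp
  also have "\<dots> = \<kappa>\<^sup>2 * (4 + 2 * T * (T + 2)\<^sup>2)"
    unfolding power_mult_distrib by (simp add: algebra_simps)
  finally show ?thesis
    using excited_matrix(2)[OF assms(3), of "W t"] by linarith
qed

text \<open>The trace converges, so its gain over windows of length \<open>T\<close> tends to zero
  and the window bound applies with arbitrarily small \<kappa>.\<close>

lemma W_tendsto_0: "(W \<longlongrightarrow> 0) at_top"
proof -
  obtain l where l: "((\<lambda>t. trace (Q t)) \<longlongrightarrow> l) at_top"
    by (rule trace_converges)
  have "filterlim (\<lambda>t. t + T) at_top at_top"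
    by (rule filterlim_at_top_mono[OF filterlim_ident]) (use T in auto)
  from tendsto_diff[OF filterlim_compose[OF l this] l]
  have d: "((\<lambda>t. trace (Q (t + T)) - trace (Q t)) \<longlongrightarrow> 0) at_top"
    by simp
  define C where "C = (4 + 2 * T * (T + 2)\<^sup>2) / (\<alpha> * T)"
  have C: "C > 0"
    using T \<alpha> by (auto simp: C_def intro!: divide_pos_pos add_pos_nonneg)
  have "((\<lambda>t. (norm (W t))\<^sup>2) \<longlongrightarrow> 0) at_top"
  proof (rule tendstoI)
    fix \<epsilon> :: real assume "\<epsilon> > 0"
    \<comment> \<open>Chosen so that \<open>\<kappa>\<^sup>2 * C\<close> is half of
      \<epsilon>.\<close>
    define \<kappa> where "\<kappa> = sqrt (\<epsilon> / (2 * C))"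
    have \<kappa>: "\<kappa> > 0" "\<kappa>\<^sup>2 = \<epsilon> / (2 * C)"
      using \<open>\<epsilon> > 0\<close> C by (simp_all add: \<kappa>_def)
    have "\<forall>\<^sub>F t in at_top. trace (Q (t + T)) - trace (Q t) < \<kappa>\<^sup>2"
      using order_tendstoD(2)[OF d, of "\<kappa>\<^sup>2"] \<kappa>(1) by simp
    then show "\<forall>\<^sub>F t in at_top. dist ((norm (W t))\<^sup>2) 0 < \<epsilon>"
      using eventually_ge_at_top[of t0] eventually_gt_at_top[of 0]
    proof eventually_elim
      case (elim t)
      have "(norm (W t))\<^sup>2 \<le> \<kappa>\<^sup>2 * C"
        using norm_W_window_le[OF \<kappa>(1) elim(2,3)] elim(1) T \<alpha>
        by (simp add: C_def pos_le_divide_eq mult_ac)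
      also have "\<dots> < \<epsilon>"
        using C \<open>\<epsilon> > 0\<close> by (simp add: \<kappa>(2))
      finally show ?case by simp
    qed
  qed
  then show ?thesis
    using tendsto_real_sqrt[of "\<lambda>t. (norm (W t))\<^sup>2" 0 at_top] by (simp add: tendsto_norm_zero_iff)
qed

text \<open>Multiplication by \<open>Q\<close> preserves the norm, and
  \<open>Q W = Q^2 - 1 = 2 R + R^2\<close> with \<open>R = Q - 1\<close>. Within distance less than
  2 of the identity, a small \<open>W\<close> thus forces a small \<open>R\<close>.\<close>

lemma norm_W_ge:
  assumes "t \<ge> t0"
  shows "norm (W t) \<ge> (2 - norm (Q t - mat 1)) * norm (Q t - mat 1)"
proof -
  let ?R = "Q t - mat 1"
  have "norm (Q t ** W t) = norm (W t)"
    by (simp add: norm_eq_sqrt_inner inner_matrix_mult_left matrix_mul_assoc SO_inverse[OF in_SO[OF assms]])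
  moreover have "Q t ** W t = 2 *\<^sub>R ?R + ?R ** ?R"
    by (simp add: W_def matrix_diff_distrib SO_inverse[OF in_SO[OF assms]] scaleR_2)
  moreover have "2 * norm ?R - norm ?R * norm ?R \<le> norm (2 *\<^sub>R ?R + ?R ** ?R)"
    using norm_diff_ineq[of "2 *\<^sub>R ?R" "?R ** ?R"] norm_matrix_mult_le[of ?R ?R] by simp
  ultimately show ?thesis
    by (simp add: algebra_simps)
qed

text \<open>On \<open>SO\<close> the squared distance to the identity is a decreasing affine
  function of the trace.\<close>

lemma norm_diff_mat_1_mono:
  assumes "t \<ge> t0"
  shows "norm (Q t - mat 1) \<le> norm (Q t0 - mat 1)"
  by (rule power2_le_imp_le)
    (use trace_mono[OF order_refl assms] in \<open>simp_all add: norm_diff_mat_1_SO in_SO assms\<close>)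

text \<open>The distance to the identity never grows, so the factor
  \<open>2 - norm (Q t - mat 1)\<close> stays at least 1/2 and \<open>W\<close> controls the
  distance for all time.\<close>

lemma tendsto_mat_1:
  assumes "f_s (Q t0) < 2"
  shows "(Q \<longlongrightarrow> mat 1) at_top"
proof -
  \<comment> \<open>3/2 is a rational number between the square root of 2 and 2.\<close>
  have "(norm (Q t0 - mat 1))\<^sup>2 < (3/2)\<^sup>2"
    using assms by (simp add: f_s_eq power2_eq_square)
  then have "norm (Q t0 - mat 1) < 3/2"
    by (rule power2_less_imp_less) simp
  then have le: "norm (Q t - mat 1) \<le> 2 * norm (W t)" if "t \<ge> t0" for t
  proof -
    have "norm (Q t - mat 1) \<le> 3/2"
      using norm_diff_mat_1_mono[OF that] \<open>norm (Q t0 - mat 1) < 3/2\<close> by linarith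
    then have "1/2 * norm (Q t - mat 1) \<le> (2 - norm (Q t - mat 1)) * norm (Q t - mat 1)"
      by (intro mult_right_mono) auto
    then show ?thesis
      using norm_W_ge[OF that] by linarith
  qed
  have "((\<lambda>t. Q t - mat 1) \<longlongrightarrow> 0) at_top"
  proof (rule Lim_null_comparison)
    show "\<forall>\<^sub>F t in at_top. norm (Q t - mat 1) \<le> 2 * norm (W t)"
      using eventually_ge_at_top[of t0] by eventually_elim (rule le)
    show "((\<lambda>t. 2 * norm (W t)) \<longlongrightarrow> 0) at_top"
      using tendsto_mult[OF tendsto_const[of 2] tendsto_norm[OF W_tendsto_0]] by simp
  qed
  then show ?thesis
    by (rule LIM_zero_cancel)
qed

section \<open>Limit points of excited trajectories\<close>

lemma omega_limit_nonempty: "omega_limit Q \<noteq> {}"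
proof -
  \<comment> \<open>Sampling from \<open>t0\<close> on stays in the compact set \<open>SO\<close>; a
    convergent subsequence supplies a limit point.\<close>
  have "\<forall>k. Q (t0 + real k) \<in> SO"
    using in_SO by simp
  then obtain P r where r: "strict_mono (r :: nat \<Rightarrow> nat)" and P: "((\<lambda>k. Q (t0 + real k)) \<circ> r) \<longlonglongrightarrow> P"
    using seq_compactE[OF compact_imp_seq_compact[OF compact_SO], of "\<lambda>k. Q (t0 + real k)"] by blast
  have "filterlim (\<lambda>k. t0 + real (r k)) at_top sequentially"
    by (intro filterlim_tendsto_add_at_top[OF tendsto_const]
        filterlim_compose[OF filterlim_real_sequentially filterlim_subseq[OF r]])
  then have "P \<in> omega_limit Q"
    using P by (auto simp: omega_limit_def o_def)
  then show ?thesis by blast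
qed

lemma omega_limit_properties:
  assumes "P \<in> omega_limit Q" and l: "((\<lambda>t. trace (Q t)) \<longlongrightarrow> l) at_top"
  shows "P \<in> SO" "transpose P = P" "trace P = l"
proof -
  obtain s where s: "filterlim s at_top sequentially" and P: "(\<lambda>k. Q (s k)) \<longlonglongrightarrow> P"
    using assms(1) by (auto simp: omega_limit_def)
  have "\<forall>\<^sub>F k in sequentially. s k \<ge> t0"
    using s by (simp add: filterlim_at_top)
  then have "\<forall>\<^sub>F k in sequentially. Q (s k) \<in> SO"
    by eventually_elim (rule in_SO)
  then show "P \<in> SO"
    by (rule Lim_in_closed_set[OF closed_SO _ _ P]) simp
  have "(\<lambda>k. W (s k)) \<longlonglongrightarrow> P - transpose P"
    unfolding W_def by (intro tendsto_intros P bounded_linear.tendsto[OF bounded_linear_transpose])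
  from LIMSEQ_unique[OF this filterlim_compose[OF W_tendsto_0 s]] show "transpose P = P"
    by simp
  from LIMSEQ_unique[OF bounded_linear.tendsto[OF bounded_linear_trace P] filterlim_compose[OF l s]]
  show "trace P = l" .
qed

text \<open>The trace never decreases, so a trajectory that starts close to the limit set but
  with larger trace stays away from it.\<close>
lemma locally_attractive_imp_C_s:
  assumes "locally_attractive y (omega_limit Q)"
  shows "omega_limit Q = C_s"
proof (rule ccontr)
  assume ne: "omega_limit Q \<noteq> C_s"
  obtain l where l: "((\<lambda>t. trace (Q t)) \<longlongrightarrow> l) at_top"
    by (rule trace_converges)
  obtain P where P: "P \<in> omega_limit Q" "P \<noteq> mat 1"
    using ne omega_limit_nonempty by (auto simp: C_s_def)
  \<comment> \<open>Attractivity is used at initial time 0, whatever the initial time of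
    \<open>Q\<close>.\<close>
  obtain \<eta> where \<eta>: "\<eta> > 0"
    "\<And>Q'. trajectory y 0 Q' \<Longrightarrow> infdist (Q' 0) (omega_limit Q) < \<eta> \<Longrightarrow> converges_to Q' (omega_limit Q)"
    using assms unfolding locally_attractive_def by (metis order_refl)
  obtain R where R: "R \<in> SO" "dist R P < \<eta>" "trace R > trace P"
    using symmetric_rotation_increase_trace[OF omega_limit_properties(1,2)[OF P(1) l] P(2) \<eta>(1)] .
  obtain Q' where Q': "trajectory y 0 Q'" "Q' 0 = R"
    using trajectory_exists[OF continuous_y norm_y R(1)] .
  interpret Q': excited_trajectory y T \<alpha> 0 Q'
    by unfold_locales (simp_all add: Q'(1))
  \<comment> \<open>Cauchy-Schwarz against the identity turns the trace gap into a distance at least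
    \<open>(trace R - l) / K\<close>; adding 1 makes \<open>K\<close> evidently positive.\<close>
  define K where "K = norm (mat 1 :: real^'n^'n) + 1"
  have K: "K > 0"
    by (simp add: K_def add_nonneg_pos)
  have "converges_to Q' (omega_limit Q)"
    using infdist_le[OF P(1), of R] R(2) by (intro \<eta>(2) Q'(1)) (simp add: Q'(2))
  then have "((\<lambda>t. infdist (Q' t) (omega_limit Q)) \<longlongrightarrow> 0) at_top"
    by (simp add: converges_to_def)
  moreover have "\<forall>\<^sub>F t in at_top. (trace R - l) / K \<le> infdist (Q' t) (omega_limit Q)"
    using eventually_ge_at_top[of 0]
  proof eventually_elim
    case (elim t)
    have "(trace R - l) / K \<le> dist (Q' t) p" if p: "p \<in> omega_limit Q" for p
    proof -
      have "trace R - l \<le> trace (Q' t - p)"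
        using Q'.trace_mono[OF order_refl elim] omega_limit_properties(3)[OF p l]
        by (simp add: Q'(2) trace_linear)
      also have "\<dots> \<le> norm (Q' t - p) * norm (mat 1 :: real^'n^'n)"
        unfolding trace_eq_inner_mat_1 by (rule norm_cauchy_schwarz)
      also have "\<dots> \<le> dist (Q' t) p * K"
        by (simp add: K_def dist_norm mult_left_mono)
      finally show ?thesis
        using K by (simp add: pos_divide_le_eq)
    qed
    then show ?case
      using omega_limit_nonempty unfolding infdist_def by (auto intro!: cINF_greatest)
  qed
  ultimately have "(trace R - l) / K \<le> 0"
    by (intro tendsto_lowerbound[of _ _ at_top]) auto
  moreover have "trace R > l"
    using R(3) omega_limit_properties(3)[OF P(1) l] by simp
  ultimately show False
    using K by (simp add: divide_le_0_iff)
qed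

end

section \<open>The identity as the only asymptotically stable limit set\<close>

context excited_reference
begin

lemma excited_trajectoryI: "t0 \<ge> 0 \<Longrightarrow> trajectory y t0 Q \<Longrightarrow> excited_trajectory y T \<alpha> t0 Q"
  by unfold_locales

text \<open>The identity is an equilibrium, so it is the limit set of its own constant
  trajectory.\<close>

lemma limit_set_C_s: "limit_set y C_s"
proof -
  have "trajectory y 0 (\<lambda>_. mat 1)"
    by (rule trajectoryI) (simp_all add: mat_1_in_SO transpose_mat)
  moreover have "omega_limit (\<lambda>_. mat 1) = C_s"
    using filterlim_real_sequentially
    by (auto simp: omega_limit_def C_s_def tendsto_const_iff)
  ultimately show ?thesis
    unfolding limit_set_def by (metis order_refl)
qed

lemma asymptotically_stable_C_s: "asymptotically_stable y C_s"
  unfolding asymptotically_stable_def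
proof
  show "stable y C_s"
    unfolding stable_def
  proof (intro allI impI)
    fix t0 \<epsilon> :: real assume t0: "0 \<le> t0" and "0 < \<epsilon>"
    have "infdist (Q t) C_s < \<epsilon>" if "trajectory y t0 Q \<and> infdist (Q t0) C_s < \<epsilon>" "t \<ge> t0" for Q t
    proof -
      interpret excited_trajectory y T \<alpha> t0 Q
        using excited_trajectoryI[OF t0] that by blast
      show ?thesis
        using norm_diff_mat_1_mono[OF that(2)] that(1) by (simp add: infdist_C_s)
    qed
    then show "\<exists>\<delta>>0. \<forall>Q. trajectory y t0 Q \<and> infdist (Q t0) C_s < \<delta> \<longrightarrow> (\<forall>t\<ge>t0. infdist (Q t) C_s < \<epsilon>)"
      using \<open>0 < \<epsilon>\<close> by blast
  qed
  show "locally_attractive y C_s"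
    unfolding locally_attractive_def
  proof (intro allI impI)
    fix t0 :: real assume t0: "0 \<le> t0"
    \<comment> \<open>Radius 1 suffices, since it gives
      \<open>f_s (Q t0) \<le> 1 < 2\<close>.\<close>
    have "converges_to Q C_s" if "trajectory y t0 Q \<and> infdist (Q t0) C_s < 1" for Q
    proof -
      interpret excited_trajectory y T \<alpha> t0 Q
        using excited_trajectoryI[OF t0] that by blast
      have "(norm (Q t0 - mat 1))\<^sup>2 \<le> 1"
        using that by (simp add: infdist_C_s power_le_one)
      then show ?thesis
        using tendsto_mat_1 by (simp add: f_s_eq converges_to_C_s_iff)
    qed
    then show "\<exists>\<eta>>0. \<forall>Q. trajectory y t0 Q \<and> infdist (Q t0) C_s < \<eta> \<longrightarrow> converges_to Q C_s"
      using zero_less_one by blast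
  qed
qed

lemma asymptotically_stable_limit_set_iff:
  "limit_set y L \<and> asymptotically_stable y L \<longleftrightarrow> L = C_s"
proof
  assume L: "limit_set y L \<and> asymptotically_stable y L"
  then obtain t0 Q where Q: "t0 \<ge> 0" "trajectory y t0 Q" "L = omega_limit Q"
    by (auto simp: limit_set_def)
  interpret excited_trajectory y T \<alpha> t0 Q
    using excited_trajectoryI[OF Q(1,2)] .
  show "L = C_s"
    using locally_attractive_imp_C_s L by (simp add: Q(3) asymptotically_stable_def)
qed (simp add: limit_set_C_s asymptotically_stable_C_s)

lemma converges_to_C_s:
  assumes "t0 \<ge> 0" "trajectory y t0 Q" "Q t0 \<in> SO - S_1"
  shows "converges_to Q C_s"
proof -
  interpret excited_trajectory y T \<alpha> t0 Q
    using excited_trajectoryI[OF assms(1,2)] .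
  show ?thesis
    using tendsto_mat_1 assms(3) by (auto simp: S_1_def converges_to_C_s_iff)
qed

end

lemma smooth_within_imp_continuous_on:
  assumes "smooth_within f S"
  shows "continuous_on S f"
proof -
  obtain D where D: "\<forall>t\<in>S. D 0 t = f t"
    "\<forall>k. \<forall>t\<in>S. (D k has_vector_derivative D (Suc k) t) (at t within S)"
    using assms unfolding smooth_within_def by blast
  then have "continuous_on S (D (0::nat))"
    unfolding continuous_on_eq_continuous_within by (blast intro: has_vector_derivative_continuous)
  then show ?thesis
    using D(1) by (simp cong: continuous_on_cong)
qed

section \<open>Constant and time-varying reference directions combined\<close>

theorem proposition1:
  assumes "CARD('n::finite) > 2"
  shows
    "(\<forall>y :: real^'n. y \<in> sphere 0 1 \<longrightarrow>
        Z_y y = {Q \<in> SO. \<forall>P\<in>SO. f_o y P \<le> f_o y Q} \<and>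
        (\<forall>Q. trajectory (\<lambda>_. y) 0 Q \<and> Q 0 \<in> SO - Z_y y \<longrightarrow> converges_to Q (C_o y)) \<and>
        locally_exponentially_convergent (\<lambda>_. y) (C_o y) \<and>
        (\<forall>Q. trajectory (\<lambda>_. y) 0 Q \<and> Q 0 \<in> S_0 y \<longrightarrow> converges_to Q C_s) \<and>
        (\<forall>Q. trajectory (\<lambda>_. y) 0 Q \<and> converges_to Q C_s \<longrightarrow> Q 0 \<in> S_0 y))
     \<and>
     (\<forall>y :: real \<Rightarrow> real^'n.
        (\<forall>t\<ge>0. y t \<in> sphere 0 1) \<and>
        smooth_within y {0..} \<and>
        bounded ((\<lambda>t. vector_derivative y (at t within {0..})) ` {0..}) \<and>
        (\<exists>T>0. \<exists>\<alpha>>0. \<forall>t>0.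
           positive_definite
             ((1/T) *\<^sub>R integral {t..t+T} (\<lambda>\<tau>. M12 (y \<tau>)) - \<alpha> *\<^sub>R mat 1)) \<longrightarrow>
        (\<forall>L. limit_set y L \<and> asymptotically_stable y L \<longleftrightarrow> L = C_s) \<and>
        (\<forall>t0\<ge>0. \<forall>Q. trajectory y t0 Q \<and> Q t0 \<in> SO - S_1 \<longrightarrow> converges_to Q C_s))"
proof (intro conjI allI impI)
  fix y :: "real^'n" assume "y \<in> sphere 0 1"
  then have y: "norm y = 1"
    by simp
  have n: "2 \<le> CARD('n)"
    using assms by simp
  show "Z_y y = {Q \<in> SO. \<forall>P\<in>SO. f_o y P \<le> f_o y Q}"
    by (rule Z_y_eq[OF n y])
  show "converges_to Q (C_o y)" if "trajectory (\<lambda>_. y) 0 Q \<and> Q 0 \<in> SO - Z_y y" for Q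
  proof -
    interpret constant_reference y Q
      by unfold_locales (use y that in auto)
    show ?thesis
      using converges_to_C_o c0_eq_minus_1_iff that by blast
  qed
  \<comment> \<open>The witnesses for local exponential convergence: radius 1, constant 12 and rate
    1.\<close>
  have "infdist (Q t) (C_o y) \<le> 12 * exp (- 1 * t) * infdist (Q 0) (C_o y)"
    if "trajectory (\<lambda>_. y) 0 Q \<and> infdist (Q 0) (C_o y) < 1" "t \<ge> 0" for Q t
  proof -
    interpret constant_reference y Q
      by unfold_locales (use y that in auto)
    show ?thesis
      using infdist_C_o_exponential that by simp
  qed
  then show "locally_exponentially_convergent (\<lambda>_. y) (C_o y)"
    unfolding locally_exponentially_convergent_def
    by (intro exI[of _ 1] exI[of _ 12] conjI) auto
  show "converges_to Q C_s" if "trajectory (\<lambda>_. y) 0 Q \<and> Q 0 \<in> S_0 y" for Q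
  proof -
    interpret constant_reference y Q
      by unfold_locales (use y that in auto)
    show ?thesis
      using S_0_imp_tendsto that by (simp add: converges_to_C_s_iff)
  qed
  show "Q 0 \<in> S_0 y" if "trajectory (\<lambda>_. y) 0 Q \<and> converges_to Q C_s" for Q
  proof -
    interpret constant_reference y Q
      by unfold_locales (use y that in auto)
    show ?thesis
      using tendsto_mat_1_imp_S_0[OF n] that by (simp add: converges_to_C_s_iff)
  qed
next
  fix y :: "real \<Rightarrow> real^'n"
  assume *: "(\<forall>t\<ge>0. y t \<in> sphere 0 1) \<and>
        smooth_within y {0..} \<and>
        bounded ((\<lambda>t. vector_derivative y (at t within {0..})) ` {0..}) \<and>
        (\<exists>T>0. \<exists>\<alpha>>0. \<forall>t>0.
           positive_definite
             ((1/T) *\<^sub>R integral {t..t+T} (\<lambda>\<tau>. M12 (y \<tau>)) - \<alpha> *\<^sub>R mat 1))"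
  then obtain T \<alpha> where T: "T > 0" "\<alpha> > 0" and pe: "\<forall>t>0. positive_definite
             ((1/T) *\<^sub>R integral {t..t+T} (\<lambda>\<tau>. M12 (y \<tau>)) - \<alpha> *\<^sub>R mat 1)"
    by blast
  have "smooth_within y {0..}"
    using * by blast
  then have y: "continuous_on {0..} y"
    by (rule smooth_within_imp_continuous_on)
  interpret excited_reference y T \<alpha>
    by unfold_locales (use * T pe y in auto)
  show "limit_set y L \<and> asymptotically_stable y L \<longleftrightarrow> L = C_s" for L
    by (rule asymptotically_stable_limit_set_iff)
  show "converges_to Q C_s" if "0 \<le> t0" "trajectory y t0 Q \<and> Q t0 \<in> SO - S_1" for t0 Q
    using converges_to_C_s that by blast
qed

end
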